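(* Let $(M^n,P)$ be a regular Poisson manifold with a pseudo-Riemannian metric $g$ whose restriction to each symplectic leaf is non-degenerate, and let $\nabla$ be the Levi-Civita covariant derivative of $g$. Let $\omega^1,\dots,\omega^d$ be a local basis of $C(M)=\ker P$, defined on a coordinate domain $U\subset M$ with coordinates $x^\alpha$, and let $\xi_i=(\omega^i)^\sharp$ be the corresponding local basis of $\mathcal N$. Then the following statements (all understood over $U$) are equivalent: (1) The distribution $\mathcal N$ is integrable. (2) For all $i,j\le d$ and all $\tau\le n$, $$P^{\tau\sigma}\left(\nabla_{\xi_i}\omega^j_\sigma-\nabla_{\xi_j}\omega^i_\sigma\right)=0.$$ (3) For all $i,j\le d$ and all $\tau\le n$, $$g^{\lambda\alpha}(\nabla_\lambda P)^{\tau\sigma}(\omega^i\wedge\omega^j)_{\sigma\alpha}=0,$$ where $\nabla_\lambda=\nabla_{\partial/\partial x^\lambda}$. (4) For all $i,j\le d$ and all $\tau\le n$, $$P^{\tau\sigma}g_{\sigma\lambda}\left(\nabla_{\xi_i}\xi_j^\lambda-\nabla_{\xi_j}\xi_i^\lambda\right)=0.$$ (5) The sub-bundle $C(M)$ is invariant under the skew-symmetric bracket of 1-forms $[\alpha,\beta]_g=[\alpha^\sharp,\beta^\sharp]^\flat$, i.e. if $\alpha,\beta\in\Gamma(C(M))$ then $[\alpha,\beta]_g\in\Gamma(C(M))$.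
   Context: Regular Poisson manifold: an $n$-dimensional manifold $M$ with a Poisson bivector $P=(P^{\tau\sigma})$ of constant rank $k$, $2\le k<n$. $P$ is viewed as a bundle map $T^*M\to TM$, $(P\alpha)^\tau=P^{\tau\sigma}\alpha_\sigma$. Its image is the integrable distribution $T(\mathcal S)$ of tangent spaces to the symplectic leaves; its kernel is the sub-bundle $C(M)\subset T^*M$ of Casimir covectors, of rank $d=n-k$. $\mathcal N=T(\mathcal S)^\perp$ is the $g$-orthogonal complement of $T(\mathcal S)$, so $TM=T(\mathcal S)\oplus\mathcal N$; the vector fields $\xi_i=(\omega^i)^\sharp$ form a local basis of $\mathcal N$. The maps $\sharp:T^*M\to TM$ and $\flat:TM\to T^*M$ are the index raising and lowering isomorphisms of $g$. A distribution is integrable iff it is involutive (Frobenius). $\nabla_{\xi}\omega_\sigma$ and $\nabla_\xi\eta^\lambda$ denote the components $(\nabla_\xi\omega)_\sigma$ and $(\nabla_\xi\eta)^\lambda$. $(\omega^i\wedge\omega^j)_{\sigma\alpha}=\omega^i_\sigma\omega^j_\alpha-\omega^i_\alpha\omega^j_\sigma$. $[\cdot,\cdot]$ is the Lie bracket of vector fields. Summation over repeated coordinate indices is understood. *)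

theory Defs
  imports "HOL-Analysis.Analysis"
begin

text \<open>Only meaningful on open sets: derivatives are taken in the ambient space.\<close>

primrec Ck_on :: "nat \<Rightarrow> 'a::euclidean_space set \<Rightarrow> ('a \<Rightarrow> 'b::real_normed_vector) \<Rightarrow> bool" where
  "Ck_on 0 S f \<longleftrightarrow> continuous_on S f"
| "Ck_on (Suc r) S f \<longleftrightarrow>
     (\<forall>x\<in>S. f differentiable (at x)) \<and>
     (\<forall>v. Ck_on r S (\<lambda>x. frechet_derivative f (at x) v))"

definition smooth_on :: "'a::euclidean_space set \<Rightarrow> ('a \<Rightarrow> 'b::real_normed_vector) \<Rightarrow> bool" where
  "smooth_on S f \<longleftrightarrow> (\<forall>r. Ck_on r S f)"

definition pd :: "(real^'n \<Rightarrow> real) \<Rightarrow> 'n::finite \<Rightarrow> real^'n \<Rightarrow> real" where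
  "pd f l x = frechet_derivative f (at x) (axis l 1)"

text \<open>The manifold is a whole Hausdorff, second countable type \<open>'m\<close>. Its dimension is
  \<open>CARD('n)\<close>, and coordinate indices range over \<open>'n\<close>. A chart is a pair \<open>(U, x)\<close>.\<close>

type_synonym ('m, 'n) chart = "'m set \<times> ('m \<Rightarrow> real^'n)"

definition cdom :: "('m, 'n) chart \<Rightarrow> 'm set" where
  "cdom c = fst c"

definition crange :: "('m, 'n) chart \<Rightarrow> (real^'n) set" where
  "crange c = snd c ` fst c"

definition transition :: "('m, 'n) chart \<Rightarrow> ('m, 'n) chart \<Rightarrow> real^'n \<Rightarrow> real^'n" where
  "transition c c' = snd c' \<circ> inv_into (cdom c) (snd c)"

definition overlap :: "('m, 'n) chart \<Rightarrow> ('m, 'n) chart \<Rightarrow> (real^'n) set" where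
  "overlap c c' = snd c ` (cdom c \<inter> cdom c')"

definition smooth_atlas ::
    "('m::{t2_space,second_countable_topology}, 'n::finite) chart set \<Rightarrow> bool" where
  "smooth_atlas A \<longleftrightarrow>
     (\<Union>c\<in>A. cdom c) = UNIV \<and>
     (\<forall>c\<in>A. open (cdom c) \<and> open (crange c) \<and>
        homeomorphism (cdom c) (crange c) (snd c) (inv_into (cdom c) (snd c))) \<and>
     (\<forall>c\<in>A. \<forall>c'\<in>A. smooth_on (overlap c c') (transition c c'))"

text \<open>A tensor field of rank two on the manifold is the family of its component matrices: for each
  chart \<open>c\<close>, a smooth function of the coordinates, i.e. a function on \<open>crange c\<close>, subject to the
  transformation law on overlaps.\<close>

type_synonym ('m, 'n) tensor2 = "('m, 'n) chart \<Rightarrow> real^'n \<Rightarrow> real^'n^'n"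

definition contravariant2 ::
    "('m::{t2_space,second_countable_topology}, 'n::finite) chart set \<Rightarrow> ('m, 'n) tensor2 \<Rightarrow> bool" where
  "contravariant2 A T \<longleftrightarrow>
     (\<forall>c\<in>A. smooth_on (crange c) (T c)) \<and>
     (\<forall>c\<in>A. \<forall>c'\<in>A. \<forall>x\<in>overlap c c'.
        T c' (transition c c' x) =
          jacobian (transition c c') (at x) ** T c x ** transpose (jacobian (transition c c') (at x)))"

definition covariant2 ::
    "('m::{t2_space,second_countable_topology}, 'n::finite) chart set \<Rightarrow> ('m, 'n) tensor2 \<Rightarrow> bool" where
  "covariant2 A T \<longleftrightarrow>
     (\<forall>c\<in>A. smooth_on (crange c) (T c)) \<and>
     (\<forall>c\<in>A. \<forall>c'\<in>A. \<forall>x\<in>overlap c c'.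
        T c x =
          transpose (jacobian (transition c c') (at x)) ** T c' (transition c c' x) **
            jacobian (transition c c') (at x))"

text \<open>\<open>p x $ \<tau> $ \<sigma>\<close> is the component with upper indices \<open>\<tau>\<close>, \<open>\<sigma>\<close>, and the bundle map from covectors
  to vectors is \<open>p x *v \<alpha>\<close>.\<close>

definition poisson_bracket ::
    "(real^'n \<Rightarrow> real^'n^'n) \<Rightarrow> (real^'n \<Rightarrow> real) \<Rightarrow> (real^'n \<Rightarrow> real) \<Rightarrow> real^'n::finite \<Rightarrow> real" where
  "poisson_bracket p f h x = (\<Sum>\<tau>\<in>UNIV. \<Sum>\<sigma>\<in>UNIV. p x $ \<tau> $ \<sigma> * pd f \<tau> x * pd h \<sigma> x)"

definition poisson_bivector ::
    "('m::{t2_space,second_countable_topology}, 'n::finite) chart set \<Rightarrow> ('m, 'n) tensor2 \<Rightarrow> bool" where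
  "poisson_bivector A P \<longleftrightarrow>
     contravariant2 A P \<and>
     (\<forall>c\<in>A. \<forall>x\<in>crange c. transpose (P c x) = - P c x) \<and>
     (\<forall>c\<in>A. \<forall>e f h. smooth_on (crange c) e \<longrightarrow> smooth_on (crange c) f \<longrightarrow> smooth_on (crange c) h \<longrightarrow>
        (\<forall>x\<in>crange c.
           poisson_bracket (P c) e (poisson_bracket (P c) f h) x +
           poisson_bracket (P c) f (poisson_bracket (P c) h e) x +
           poisson_bracket (P c) h (poisson_bracket (P c) e f) x = 0))"

definition regular_poisson ::
    "('m::{t2_space,second_countable_topology}, 'n::finite) chart set \<Rightarrow> ('m, 'n) tensor2 \<Rightarrow> nat \<Rightarrow> bool" where
  "regular_poisson A P k \<longleftrightarrow>
     poisson_bivector A P \<and> (\<forall>c\<in>A. \<forall>x\<in>crange c. rank (P c x) = k) \<and> 2 \<le> k \<and> k < CARD('n)"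

definition pseudo_riemannian ::
    "('m::{t2_space,second_countable_topology}, 'n::finite) chart set \<Rightarrow> ('m, 'n) tensor2 \<Rightarrow> bool" where
  "pseudo_riemannian A g \<longleftrightarrow>
     covariant2 A g \<and>
     (\<forall>c\<in>A. \<forall>x\<in>crange c. transpose (g c x) = g c x \<and> invertible (g c x))"

definition leaf_tangent :: "real^'n^'n \<Rightarrow> (real^'n) set" where
  "leaf_tangent p = range (\<lambda>\<alpha>. p *v \<alpha>)"

definition casimir :: "real^'n^'n \<Rightarrow> (real^'n) set" where
  "casimir p = {\<alpha>. p *v \<alpha> = 0}"

definition leaf_orthogonal :: "real^'n^'n \<Rightarrow> real^'n^'n \<Rightarrow> (real^'n) set" where
  "leaf_orthogonal p q = {v. \<forall>w\<in>leaf_tangent p. v \<bullet> (q *v w) = 0}"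

text \<open>The tangent space of the leaf through a point is the image of the Poisson tensor there.\<close>

definition nondegenerate_on_leaves ::
    "('m::{t2_space,second_countable_topology}, 'n::finite) chart set \<Rightarrow>
      ('m, 'n) tensor2 \<Rightarrow> ('m, 'n) tensor2 \<Rightarrow> bool" where
  "nondegenerate_on_leaves A P g \<longleftrightarrow>
     (\<forall>c\<in>A. \<forall>x\<in>crange c. \<forall>v\<in>leaf_tangent (P c x).
        (\<forall>w\<in>leaf_tangent (P c x). v \<bullet> (g c x *v w) = 0) \<longrightarrow> v = 0)"

text \<open>From here on \<open>D\<close> is the open coordinate image of a chart; vector fields and 1-forms on the
  coordinate domain are given by their components as functions on \<open>D\<close>, and \<open>p\<close>, \<open>q\<close> are the
  component matrices of the Poisson tensor and of the metric.\<close>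

definition casimir_forms ::
    "(real^'n) set \<Rightarrow> (real^'n \<Rightarrow> real^'n^'n) \<Rightarrow> (real^'n::finite \<Rightarrow> real^'n) set" where
  "casimir_forms D p = {\<alpha>. smooth_on D \<alpha> \<and> (\<forall>x\<in>D. \<alpha> x \<in> casimir (p x))}"

definition casimir_basis ::
    "(real^'n) set \<Rightarrow> (real^'n \<Rightarrow> real^'n^'n) \<Rightarrow> ('d::finite \<Rightarrow> real^'n::finite \<Rightarrow> real^'n) \<Rightarrow> bool" where
  "casimir_basis D p \<omega> \<longleftrightarrow>
     (\<forall>i. smooth_on D (\<omega> i)) \<and>
     (\<forall>x\<in>D. inj (\<lambda>i. \<omega> i x) \<and> independent (range (\<lambda>i. \<omega> i x)) \<and>
        span (range (\<lambda>i. \<omega> i x)) = casimir (p x))"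

definition flat :: "(real^'n \<Rightarrow> real^'n^'n) \<Rightarrow> (real^'n \<Rightarrow> real^'n) \<Rightarrow> real^'n \<Rightarrow> real^'n" where
  "flat q X x = q x *v X x"

definition sharp :: "(real^'n \<Rightarrow> real^'n^'n) \<Rightarrow> (real^'n \<Rightarrow> real^'n) \<Rightarrow> real^'n \<Rightarrow> real^'n" where
  "sharp q \<alpha> x = matrix_inv (q x) *v \<alpha> x"

definition lie_bracket ::
    "(real^'n \<Rightarrow> real^'n) \<Rightarrow> (real^'n \<Rightarrow> real^'n) \<Rightarrow> real^'n::finite \<Rightarrow> real^'n" where
  "lie_bracket X Y x =
     (\<chi> l. \<Sum>\<mu>\<in>UNIV. X x $ \<mu> * pd (\<lambda>y. Y y $ l) \<mu> x - Y x $ \<mu> * pd (\<lambda>y. X y $ l) \<mu> x)"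

definition form_bracket ::
    "(real^'n \<Rightarrow> real^'n^'n) \<Rightarrow> (real^'n \<Rightarrow> real^'n) \<Rightarrow> (real^'n \<Rightarrow> real^'n) \<Rightarrow> real^'n::finite \<Rightarrow> real^'n" where
  "form_bracket q \<alpha> \<beta> = flat q (lie_bracket (sharp q \<alpha>) (sharp q \<beta>))"

definition wedge :: "real^'n \<Rightarrow> real^'n \<Rightarrow> 'n \<Rightarrow> 'n \<Rightarrow> real" where
  "wedge \<alpha> \<beta> \<sigma> \<rho> = \<alpha> $ \<sigma> * \<beta> $ \<rho> - \<alpha> $ \<rho> * \<beta> $ \<sigma>"

text \<open>A distribution is integrable if every point lies on an integral manifold: the image of an
  injective immersion of an open subset of a Euclidean space \<open>real^'d\<close> whose tangent spaces are the
  given ones. The type argument carries the rank of the distribution, \<open>CARD('d)\<close>.\<close>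

definition integrable_distribution ::
    "'d::finite itself \<Rightarrow> (real^'n) set \<Rightarrow> (real^'n::finite \<Rightarrow> (real^'n) set) \<Rightarrow> bool" where
  "integrable_distribution _ D E \<longleftrightarrow>
     (\<forall>x\<in>D. \<exists>(W :: (real^'d) set) f.
        open W \<and> smooth_on W f \<and> inj_on f W \<and> f ` W \<subseteq> D \<and> x \<in> f ` W \<and>
        (\<forall>w\<in>W. inj (frechet_derivative f (at w)) \<and>
                range (frechet_derivative f (at w)) = E (f w)))"

text \<open>\<open>christoffel q x \<kappa> l \<mu>\<close> has upper index \<open>\<kappa>\<close> and lower indices \<open>l\<close>, \<open>\<mu>\<close>, the differentiation
  index being \<open>l\<close>. The lemmas below state that these are the coefficients of the unique torsion-free
  metric connection.\<close>

definition christoffel ::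
    "(real^'n \<Rightarrow> real^'n^'n) \<Rightarrow> real^'n::finite \<Rightarrow> 'n \<Rightarrow> 'n \<Rightarrow> 'n \<Rightarrow> real" where
  "christoffel q x \<kappa> l \<mu> =
     (\<Sum>\<rho>\<in>UNIV. matrix_inv (q x) $ \<kappa> $ \<rho> *
        (pd (\<lambda>y. q y $ \<rho> $ \<mu>) l x + pd (\<lambda>y. q y $ \<rho> $ l) \<mu> x - pd (\<lambda>y. q y $ l $ \<mu>) \<rho> x)) / 2"

text \<open>In the covariant derivatives the first field is the direction of differentiation.\<close>

definition cov_vector ::
    "(real^'n \<Rightarrow> real^'n^'n) \<Rightarrow> (real^'n \<Rightarrow> real^'n) \<Rightarrow> (real^'n \<Rightarrow> real^'n) \<Rightarrow> real^'n::finite \<Rightarrow> real^'n" where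
  "cov_vector q X \<eta> x =
     (\<chi> l. \<Sum>\<mu>\<in>UNIV. X x $ \<mu> *
        (pd (\<lambda>y. \<eta> y $ l) \<mu> x + (\<Sum>\<nu>\<in>UNIV. christoffel q x l \<mu> \<nu> * \<eta> x $ \<nu>)))"

definition cov_form ::
    "(real^'n \<Rightarrow> real^'n^'n) \<Rightarrow> (real^'n \<Rightarrow> real^'n) \<Rightarrow> (real^'n \<Rightarrow> real^'n) \<Rightarrow> real^'n::finite \<Rightarrow> real^'n" where
  "cov_form q X \<alpha> x =
     (\<chi> \<sigma>. \<Sum>\<mu>\<in>UNIV. X x $ \<mu> *
        (pd (\<lambda>y. \<alpha> y $ \<sigma>) \<mu> x - (\<Sum>\<nu>\<in>UNIV. christoffel q x \<nu> \<mu> \<sigma> * \<alpha> x $ \<nu>)))"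

definition cov_bivector ::
    "(real^'n \<Rightarrow> real^'n^'n) \<Rightarrow> 'n \<Rightarrow> (real^'n \<Rightarrow> real^'n^'n) \<Rightarrow> real^'n::finite \<Rightarrow> real^'n^'n" where
  "cov_bivector q l p x =
     (\<chi> \<tau> \<sigma>. pd (\<lambda>y. p y $ \<tau> $ \<sigma>) l x
        + (\<Sum>\<mu>\<in>UNIV. christoffel q x \<tau> l \<mu> * p x $ \<mu> $ \<sigma>)
        + (\<Sum>\<mu>\<in>UNIV. christoffel q x \<sigma> l \<mu> * p x $ \<tau> $ \<mu>))"

lemma matrix_inv_inverse:
  fixes B :: "real^'n^'n"
  assumes "invertible B"
  shows "B ** matrix_inv B = mat 1" "matrix_inv B ** B = mat 1"
  using someI_ex[of "\<lambda>B'. B ** B' = mat 1 \<and> B' ** B = mat 1"] assms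
  unfolding invertible_def matrix_inv_def by auto

lemma pd_metric_sym:
  fixes q :: "real^'n \<Rightarrow> real^'n^'n"
  assumes "open D" "x \<in> D" "\<And>y. y \<in> D \<Longrightarrow> transpose (q y) = q y"
  shows "pd (\<lambda>y. q y $ \<rho> $ \<mu>) l x = pd (\<lambda>y. q y $ \<mu> $ \<rho>) l x"
proof -
  have eq: "q y $ \<rho> $ \<mu> = q y $ \<mu> $ \<rho>" if "y \<in> D" for y
    using arg_cong[OF assms(3)[OF that], of "\<lambda>A. A $ \<mu> $ \<rho>"] by (simp add: transpose_def)
  have "((\<lambda>y. q y $ \<rho> $ \<mu>) has_derivative h) (at x) \<longleftrightarrow>
        ((\<lambda>y. q y $ \<mu> $ \<rho>) has_derivative h) (at x)" for h
  proof
    assume "((\<lambda>y. q y $ \<rho> $ \<mu>) has_derivative h) (at x)"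
    then show "((\<lambda>y. q y $ \<mu> $ \<rho>) has_derivative h) (at x)"
      by (rule has_derivative_transform_within_open[OF _ assms(1,2)]) (rule eq)
  next
    assume "((\<lambda>y. q y $ \<mu> $ \<rho>) has_derivative h) (at x)"
    then show "((\<lambda>y. q y $ \<rho> $ \<mu>) has_derivative h) (at x)"
      by (rule has_derivative_transform_within_open[OF _ assms(1,2)]) (rule eq[symmetric])
  qed
  then show ?thesis
    unfolding pd_def frechet_derivative_def by simp
qed

lemma christoffel_lower:
  fixes q :: "real^'n \<Rightarrow> real^'n^'n"
  assumes "invertible (q x)"
  shows "(\<Sum>\<kappa>\<in>UNIV. q x $ \<nu> $ \<kappa> * christoffel q x \<kappa> l \<mu>) =
    (pd (\<lambda>y. q y $ \<nu> $ \<mu>) l x + pd (\<lambda>y. q y $ \<nu> $ l) \<mu> x - pd (\<lambda>y. q y $ l $ \<mu>) \<nu> x) / 2"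
proof -
  define v :: "real^'n" where
    "v = (\<chi> \<rho>. (pd (\<lambda>y. q y $ \<rho> $ \<mu>) l x + pd (\<lambda>y. q y $ \<rho> $ l) \<mu> x - pd (\<lambda>y. q y $ l $ \<mu>) \<rho> x) / 2)"
  have "christoffel q x \<kappa> l \<mu> = (matrix_inv (q x) *v v) $ \<kappa>" for \<kappa>
    by (simp add: christoffel_def v_def matrix_vector_mult_def sum_divide_distrib)
  then have "(\<Sum>\<kappa>\<in>UNIV. q x $ \<nu> $ \<kappa> * christoffel q x \<kappa> l \<mu>) = (q x *v (matrix_inv (q x) *v v)) $ \<nu>"
    by (simp add: matrix_vector_mult_def)
  also have "\<dots> = v $ \<nu>"
    using matrix_inv_inverse(1)[OF assms] by (simp add: matrix_vector_mul_assoc)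
  finally show ?thesis by (simp add: v_def)
qed

lemma christoffel_torsion_free:
  fixes q :: "real^'n \<Rightarrow> real^'n^'n"
  assumes "open D" "x \<in> D" "\<And>y. y \<in> D \<Longrightarrow> transpose (q y) = q y"
  shows "christoffel q x \<kappa> l \<mu> = christoffel q x \<kappa> \<mu> l"
proof -
  note s = pd_metric_sym[of D x q, OF assms]
  show ?thesis
    unfolding christoffel_def
    by (intro arg_cong2[where f = "(/)"] sum.cong refl) (simp only: s[of l \<mu>] add.commute)
qed

lemma christoffel_metric:
  fixes q :: "real^'n \<Rightarrow> real^'n^'n"
  assumes "open D" "x \<in> D" "\<And>y. y \<in> D \<Longrightarrow> transpose (q y) = q y" "invertible (q x)"
  shows "pd (\<lambda>y. q y $ \<mu> $ \<nu>) l x =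
    (\<Sum>\<kappa>\<in>UNIV. christoffel q x \<kappa> l \<mu> * q x $ \<kappa> $ \<nu>) + (\<Sum>\<kappa>\<in>UNIV. christoffel q x \<kappa> l \<nu> * q x $ \<mu> $ \<kappa>)"
proof -
  note s = pd_metric_sym[of D x q, OF assms(1-3)]
  have "q x $ \<kappa> $ \<nu> = q x $ \<nu> $ \<kappa>" for \<kappa>
    using arg_cong[OF assms(3)[OF assms(2)], of "\<lambda>A. A $ \<nu> $ \<kappa>"] by (simp add: transpose_def)
  then have "(\<Sum>\<kappa>\<in>UNIV. christoffel q x \<kappa> l \<mu> * q x $ \<kappa> $ \<nu>)
      = (\<Sum>\<kappa>\<in>UNIV. q x $ \<nu> $ \<kappa> * christoffel q x \<kappa> l \<mu>)"
    by (simp add: mult.commute)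
  moreover have "(\<Sum>\<kappa>\<in>UNIV. christoffel q x \<kappa> l \<nu> * q x $ \<mu> $ \<kappa>)
      = (\<Sum>\<kappa>\<in>UNIV. q x $ \<mu> $ \<kappa> * christoffel q x \<kappa> l \<nu>)"
    by (simp add: mult.commute)
  ultimately show ?thesis
    using s[of \<nu> \<mu> l] s[of \<nu> l \<mu>] s[of \<mu> l \<nu>]
    by (simp only: christoffel_lower[where q = q, OF assms(4)]) (simp add: field_simps)
qed

lemma christoffel_unique:
  fixes q :: "real^'n \<Rightarrow> real^'n^'n" and \<Gamma> :: "'n \<Rightarrow> 'n \<Rightarrow> 'n \<Rightarrow> real"
  assumes "transpose (q x) = q x" "invertible (q x)"
    and sym: "\<And>\<kappa> l \<mu>. \<Gamma> \<kappa> l \<mu> = \<Gamma> \<kappa> \<mu> l"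
    and metric: "\<And>l \<mu> \<nu>. pd (\<lambda>y. q y $ \<mu> $ \<nu>) l x =
      (\<Sum>\<kappa>\<in>UNIV. \<Gamma> \<kappa> l \<mu> * q x $ \<kappa> $ \<nu>) + (\<Sum>\<kappa>\<in>UNIV. \<Gamma> \<kappa> l \<nu> * q x $ \<mu> $ \<kappa>)"
  shows "\<Gamma> \<kappa> l \<mu> = christoffel q x \<kappa> l \<mu>"
proof -
  have qs: "q x $ \<kappa> $ \<nu> = q x $ \<nu> $ \<kappa>" for \<kappa> \<nu>
    using arg_cong[OF assms(1), of "\<lambda>A. A $ \<nu> $ \<kappa>"] by (simp add: transpose_def)
  define L where "L \<nu> l \<mu> = (\<Sum>\<kappa>\<in>UNIV. q x $ \<nu> $ \<kappa> * \<Gamma> \<kappa> l \<mu>)" for \<nu> l \<mu>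
  have L: "pd (\<lambda>y. q y $ \<mu> $ \<nu>) l x = L \<nu> l \<mu> + L \<mu> l \<nu>" for l \<mu> \<nu>
    unfolding metric L_def by (simp add: mult.commute qs[of _ \<nu>])
  have Ls: "L \<nu> l \<mu> = L \<nu> \<mu> l" for \<nu> l \<mu>
    unfolding L_def by (simp add: sym[of _ l \<mu>])
  define a :: "real^'n" where "a = (\<chi> \<kappa>. \<Gamma> \<kappa> l \<mu>)"
  define b :: "real^'n" where "b = (\<chi> \<kappa>. christoffel q x \<kappa> l \<mu>)"
  have "L \<nu> l \<mu> = (\<Sum>\<kappa>\<in>UNIV. q x $ \<nu> $ \<kappa> * christoffel q x \<kappa> l \<mu>)" for \<nu>
    unfolding christoffel_lower[where q = q, OF assms(2)] L
    using Ls[of \<nu> \<mu> l] Ls[of \<mu> \<nu> l] Ls[of l \<nu> \<mu>] by simp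
  then have "q x *v a = q x *v b"
    by (simp add: vec_eq_iff matrix_vector_mult_def a_def b_def L_def)
  then have "a = b"
    using matrix_inv_inverse(2)[OF assms(2)] by (metis matrix_vector_mul_assoc matrix_vector_mul_lid)
  then show ?thesis
    by (simp add: a_def b_def vec_eq_iff)
qed

end

theory Submission
  imports Defs
begin

text \<open>Write \<open>B = P g\<close>, so that \<open>\<N> = ker B\<close>. Since \<open>\<nabla>\<close> is metric and torsion free, each of the
  conditions (2)-(5) says that \<open>B [\<xi>\<^sub>i, \<xi>\<^sub>j] = 0\<close>, and differentiating \<open>B \<xi>\<^sub>i = 0\<close> turns this into the
  symmetry of \<open>(u, v) \<mapsto> DB(u) v\<close> on \<open>ker B\<close>. Differentiating \<open>B(f w) (Df(w) a) = 0\<close> shows that an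
  integral manifold \<open>f\<close> forces this symmetry. For the converse, choose a frame \<open>S(x)\<close> of \<open>ker B(x)\<close>
  with \<open>L S(x) = id\<close> for a fixed linear map \<open>L\<close>; then the symmetry passes to
  \<open>(a, b) \<mapsto> DS(x) (S(x) a) b\<close> and makes the total differential equation \<open>Df = S \<circ> f\<close> solvable.
  The solution is the fixed point of \<open>f(w) = x\<^sub>0 + \<integral>\<^sub>0\<^sup>1 S(f(t w)) w dt\<close>, and it is smooth because \<open>Df = S \<circ> f\<close>.\<close>

section \<open>Calculus of smooth maps\<close>

text \<open>\<open>integrable_distribution\<close> asks for integral manifolds, so Frobenius'
  theorem itself has to be supplied in both directions, not only the bracket criterion. Describing
  the distribution as the kernel of a matrix field makes involutivity a pointwise condition on
  vectors, independent of any choice of fields. The integral equation is an ordinary differential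
  equation on each ray from the origin of the parameter space; integrability of the system enters
  only when neighbouring rays are compared. That comparison yields a remainder quadratic in the
  displacement, hence the full derivative. A small radius serves two purposes: it makes the Picard
  operator a contraction, and it lets the comparison of rays close by absorbing half of the quantity
  to be estimated.\<close>

lemma Ck_on_cong:
  assumes "open S" "\<And>x. x \<in> S \<Longrightarrow> f x = g x" "Ck_on r S f"
  shows "Ck_on r S g"
  using assms(2,3)
proof (induction r arbitrary: f g)
  case 0
  then show ?case by (simp cong: continuous_on_cong)
next
  case (Suc r)
  have d: "f differentiable (at x)" if "x \<in> S" for x
    using Suc.prems(2) that by simp
  have d': "(g has_derivative frechet_derivative f (at x)) (at x)" if "x \<in> S" for x
    using d[OF that] has_derivative_transform_within_open[OF _ assms(1) that Suc.prems(1)]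
    by (auto simp: frechet_derivative_works)
  then have eq: "frechet_derivative f (at x) v = frechet_derivative g (at x) v" if "x \<in> S" for x v
    using frechet_derivative_at[OF d'[OF that]] by simp
  have "Ck_on r S (\<lambda>x. frechet_derivative g (at x) v)" for v
    by (rule Suc.IH[OF eq]) (use Suc.prems(2) in auto)
  then show ?case
    using d' by (auto simp: differentiable_def)
qed

text \<open>Any explicit family of derivatives may stand in for \<open>frechet_derivative\<close>.
  The closure proofs below are inductions on the order that exhibit a derivative built from the same
  operations as the map itself.\<close>

lemma Ck_on_SucI:
  assumes "open S" "\<And>x. x \<in> S \<Longrightarrow> (f has_derivative f' x) (at x)" "\<And>v. Ck_on r S (\<lambda>x. f' x v)"
  shows "Ck_on (Suc r) S f"
proof -
  have "frechet_derivative f (at x) = f' x" if "x \<in> S" for x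
    using frechet_derivative_at[OF assms(2)[OF that]] by simp
  then show ?thesis
    using assms(2) Ck_on_cong[OF assms(1) _ assms(3)] by (auto simp: differentiable_def)
qed

lemma Ck_on_SucD:
  assumes "Ck_on (Suc r) S f"
  shows "Ck_on r S f"
  using assms
proof (induction r arbitrary: f)
  case 0
  then show ?case
    by (auto simp: continuous_on_eq_continuous_within intro!: differentiable_imp_continuous_within
        intro: differentiable_at_withinI)
qed auto

lemma Ck_on_imp_continuous_on: "Ck_on r S f \<Longrightarrow> continuous_on S f"
proof (induction r)
  case (Suc r)
  then show ?case by (blast intro: Ck_on_SucD)
qed simp

lemma Ck_on_has_derivative:
  "Ck_on (Suc r) S f \<Longrightarrow> x \<in> S \<Longrightarrow> (f has_derivative frechet_derivative f (at x)) (at x)"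
  by (simp add: frechet_derivative_works)

lemma Ck_on_subset: "Ck_on r S f \<Longrightarrow> T \<subseteq> S \<Longrightarrow> Ck_on r T f"
  by (induction r arbitrary: f) (auto intro: continuous_on_subset)

lemma Ck_on_const: "open S \<Longrightarrow> Ck_on r S (\<lambda>x. c)"
  by (induction r arbitrary: c) auto

lemma Ck_on_bounded_linear:
  assumes "bounded_linear L" "open S" "Ck_on r S f"
  shows "Ck_on r S (\<lambda>x. L (f x))"
  using assms(3)
proof (induction r arbitrary: f)
  case 0
  then show ?case
    using bounded_linear.continuous_on[OF assms(1)] by simp
next
  case (Suc r)
  show ?case
    by (rule Ck_on_SucI[OF assms(2), where f' = "\<lambda>x v. L (frechet_derivative f (at x) v)"])
      (use Suc in \<open>auto intro!: bounded_linear.has_derivative[OF assms(1)] Ck_on_has_derivative[of r S f]\<close>)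
qed

lemma Ck_on_add:
  assumes "open S" "Ck_on r S f" "Ck_on r S g"
  shows "Ck_on r S (\<lambda>x. f x + g x)"
  using assms(2,3)
proof (induction r arbitrary: f g)
  case 0
  then show ?case by (simp add: continuous_on_add)
next
  case (Suc r)
  show ?case
    by (rule Ck_on_SucI[OF assms(1),
          where f' = "\<lambda>x v. frechet_derivative f (at x) v + frechet_derivative g (at x) v"])
      (use Suc in \<open>auto intro!: has_derivative_add Ck_on_has_derivative[of r S]\<close>)
qed

lemma Ck_on_sum:
  assumes "open S" "\<And>i. i \<in> I \<Longrightarrow> Ck_on r S (f i)"
  shows "Ck_on r S (\<lambda>x. \<Sum>i\<in>I. f i x)"
  using assms(2)
  by (induction I rule: infinite_finite_induct) (auto intro!: Ck_on_const Ck_on_add assms(1))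

text \<open>By Leibniz the derivative is a sum of two terms of the same shape, each with one factor
  differentiated. Hence the induction over arbitrary \<open>f\<close> and \<open>g\<close>, in which
  the undifferentiated factor is used at one order less. Real, scalar and matrix products are all
  instances.\<close>

lemma Ck_on_bilinear:
  assumes "bounded_bilinear h" "open S" "Ck_on r S f" "Ck_on r S g"
  shows "Ck_on r S (\<lambda>x. h (f x) (g x))"
  using assms(3,4)
proof (induction r arbitrary: f g)
  case 0
  then show ?case by (simp add: bounded_bilinear.continuous_on[OF assms(1)])
next
  case (Suc r)
  show ?case
  proof (rule Ck_on_SucI[OF assms(2), where f' = "\<lambda>x v. h (f x) (frechet_derivative g (at x) v)
        + h (frechet_derivative f (at x) v) (g x)"])
    show "((\<lambda>x. h (f x) (g x)) has_derivative (\<lambda>v. h (f x) (frechet_derivative g (at x) v)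
        + h (frechet_derivative f (at x) v) (g x))) (at x)" if "x \<in> S" for x
      using Suc.prems that
      by (intro bounded_bilinear.FDERIV[OF assms(1)] Ck_on_has_derivative[of r S])
    show "Ck_on r S (\<lambda>x. h (f x) (frechet_derivative g (at x) v)
        + h (frechet_derivative f (at x) v) (g x))" for v
      using Suc.prems Ck_on_SucD[OF Suc.prems(1)] Ck_on_SucD[OF Suc.prems(2)]
      by (intro Ck_on_add assms(2) Suc.IH) auto
  qed
qed

lemma Ck_on_prod:
  fixes f :: "'i \<Rightarrow> 'a::euclidean_space \<Rightarrow> real"
  assumes "open S" "\<And>i. i \<in> I \<Longrightarrow> Ck_on r S (f i)"
  shows "Ck_on r S (\<lambda>x. \<Prod>i\<in>I. f i x)"
  using assms(2)
  by (induction I rule: infinite_finite_induct)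
    (auto intro!: Ck_on_const Ck_on_bilinear[OF bounded_bilinear_mult] assms(1))

lemma Ck_on_inverse:
  fixes f :: "'a::euclidean_space \<Rightarrow> real"
  assumes "open S" "Ck_on r S f" "\<And>x. x \<in> S \<Longrightarrow> f x \<noteq> 0"
  shows "Ck_on r S (\<lambda>x. inverse (f x))"
  using assms(2)
proof (induction r)
  case 0
  then show ?case using assms(3) by (auto intro!: continuous_intros)
next
  case (Suc r)
  show ?case
  \<comment> \<open>The derivative contains \<open>inverse (f x)\<close> again, which the induction
    hypothesis covers at order \<open>r\<close>. The sign is written as a factor so that products
    and constants suffice.\<close>
  proof (rule Ck_on_SucI[OF assms(1), where f' = "\<lambda>x v. (-1) * (inverse (f x) *
      frechet_derivative f (at x) v * inverse (f x))"])
    show "((\<lambda>x. inverse (f x)) has_derivative (\<lambda>v. (-1) * (inverse (f x) *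
      frechet_derivative f (at x) v * inverse (f x)))) (at x)" if "x \<in> S" for x
      using Suc.prems that assms(3)
      by (auto intro!: derivative_eq_intros Ck_on_has_derivative[of r S])
    show "Ck_on r S (\<lambda>x. (-1) * (inverse (f x) * frechet_derivative f (at x) v * inverse (f x)))" for v
      using Suc.prems Suc.IH[OF Ck_on_SucD[OF Suc.prems]]
      by (intro Ck_on_bilinear[OF bounded_bilinear_mult] Ck_on_const assms(1)) auto
  qed
qed

text \<open>In the chain rule the direction fed to the derivative of \<open>g\<close> varies with
  the point, whereas the induction hypothesis concerns fixed directions. Expanding that direction
  over \<open>Basis\<close> separates the two: scalar coefficients times derivatives of
  \<open>g\<close> in basis directions, composed with \<open>f\<close>.\<close>

lemma Ck_on_compose:
  fixes f :: "'a::euclidean_space \<Rightarrow> 'b::euclidean_space"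
  assumes "open S" "open T" "f ` S \<subseteq> T" "Ck_on r S f" "Ck_on r T g"
  shows "Ck_on r S (\<lambda>x. g (f x))"
  using assms(4,5)
proof (induction r arbitrary: g)
  case 0
  then show ?case using continuous_on_compose2[OF _ _ assms(3)] by simp
next
  case (Suc r)
  have df: "(f has_derivative frechet_derivative f (at x)) (at x)" if "x \<in> S" for x
    using Suc.prems that by (intro Ck_on_has_derivative[of r S])
  have dg: "(g has_derivative frechet_derivative g (at y)) (at y)" if "y \<in> T" for y
    using Suc.prems that by (intro Ck_on_has_derivative[of r T])
  have eq: "frechet_derivative g (at y) u
      = (\<Sum>b\<in>Basis. (u \<bullet> b) *\<^sub>R frechet_derivative g (at y) b)" if "y \<in> T" for y u
  proof -
    interpret linear "frechet_derivative g (at y)"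
      using has_derivative_linear[OF dg[OF that]] .
    show ?thesis
      by (subst euclidean_representation[symmetric, of u]) (simp only: sum scaleR)
  qed
  show ?case
  proof (rule Ck_on_SucI[OF assms(1), where f' = "\<lambda>x v. \<Sum>b\<in>Basis. (frechet_derivative f (at x) v \<bullet> b) *\<^sub>R
      frechet_derivative g (at (f x)) b"])
    fix x assume x: "x \<in> S"
    have "((\<lambda>x. g (f x)) has_derivative (\<lambda>v. frechet_derivative g (at (f x)) (frechet_derivative f (at x) v))) (at x)"
      using x assms(3) by (intro has_derivative_compose[OF df dg]) auto
    also have "(\<lambda>v. frechet_derivative g (at (f x)) (frechet_derivative f (at x) v)) =
      (\<lambda>v. \<Sum>b\<in>Basis. (frechet_derivative f (at x) v \<bullet> b) *\<^sub>R frechet_derivative g (at (f x)) b)"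
      using x assms(3) by (intro ext eq) auto
    finally show "((\<lambda>x. g (f x)) has_derivative (\<lambda>v. \<Sum>b\<in>Basis. (frechet_derivative f (at x) v \<bullet> b) *\<^sub>R
      frechet_derivative g (at (f x)) b)) (at x)" .
  next
    fix v
    show "Ck_on r S (\<lambda>x. \<Sum>b\<in>Basis. (frechet_derivative f (at x) v \<bullet> b) *\<^sub>R
      frechet_derivative g (at (f x)) b)"
      using Suc.prems Ck_on_SucD[OF Suc.prems(1)]
      by (intro Ck_on_sum assms(1) Ck_on_bilinear[OF bounded_bilinear_scaleR]
          Suc.IH[of "\<lambda>y. frechet_derivative g (at y) b" for b]
          Ck_on_bounded_linear[OF bounded_linear_inner_left]) auto
  qed
qed

lemma smooth_on_cong: "open S \<Longrightarrow> (\<And>x. x \<in> S \<Longrightarrow> f x = g x) \<Longrightarrow> smooth_on S f \<Longrightarrow> smooth_on S g"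
  unfolding smooth_on_def by (blast intro: Ck_on_cong)

lemma smooth_on_subset: "smooth_on S f \<Longrightarrow> T \<subseteq> S \<Longrightarrow> smooth_on T f"
  unfolding smooth_on_def by (blast intro: Ck_on_subset)

lemma smooth_on_const: "open S \<Longrightarrow> smooth_on S (\<lambda>x. c)"
  unfolding smooth_on_def by (blast intro: Ck_on_const)

lemma smooth_on_bounded_linear:
  "bounded_linear L \<Longrightarrow> open S \<Longrightarrow> smooth_on S f \<Longrightarrow> smooth_on S (\<lambda>x. L (f x))"
  unfolding smooth_on_def by (blast intro: Ck_on_bounded_linear)

lemma smooth_on_bilinear:
  "bounded_bilinear h \<Longrightarrow> open S \<Longrightarrow> smooth_on S f \<Longrightarrow> smooth_on S g \<Longrightarrow>
    smooth_on S (\<lambda>x. h (f x) (g x))"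
  unfolding smooth_on_def by (blast intro: Ck_on_bilinear)

lemma smooth_on_sum:
  "open S \<Longrightarrow> (\<And>i. i \<in> I \<Longrightarrow> smooth_on S (f i)) \<Longrightarrow> smooth_on S (\<lambda>x. \<Sum>i\<in>I. f i x)"
  unfolding smooth_on_def by (blast intro: Ck_on_sum)

lemma smooth_on_prod:
  fixes f :: "'i \<Rightarrow> 'a::euclidean_space \<Rightarrow> real"
  shows "open S \<Longrightarrow> (\<And>i. i \<in> I \<Longrightarrow> smooth_on S (f i)) \<Longrightarrow> smooth_on S (\<lambda>x. \<Prod>i\<in>I. f i x)"
  unfolding smooth_on_def by (blast intro: Ck_on_prod)

lemma smooth_on_inverse:
  fixes f :: "'a::euclidean_space \<Rightarrow> real"
  shows "open S \<Longrightarrow> smooth_on S f \<Longrightarrow> (\<And>x. x \<in> S \<Longrightarrow> f x \<noteq> 0) \<Longrightarrow> smooth_on S (\<lambda>x. inverse (f x))"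
  unfolding smooth_on_def by (blast intro: Ck_on_inverse)

lemma smooth_on_has_derivative:
  "smooth_on S f \<Longrightarrow> x \<in> S \<Longrightarrow> (f has_derivative frechet_derivative f (at x)) (at x)"
  unfolding smooth_on_def by (blast intro: Ck_on_has_derivative)

lemma smooth_on_frechet_derivative:
  "smooth_on S f \<Longrightarrow> smooth_on S (\<lambda>x. frechet_derivative f (at x) v)"
  unfolding smooth_on_def by (metis Ck_on.simps(2))

lemma smooth_on_imp_continuous_on: "smooth_on S f \<Longrightarrow> continuous_on S f"
  unfolding smooth_on_def by (blast intro: Ck_on_imp_continuous_on)

lemma smooth_on_diff:
  assumes "open S" "smooth_on S f" "smooth_on S g"
  shows "smooth_on S (\<lambda>x. f x - g x)"
proof -
  have "smooth_on S (\<lambda>x. - g x)"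
    using smooth_on_bounded_linear[OF bounded_linear_minus[OF bounded_linear_ident] assms(1,3)] by simp
  then have "smooth_on S (\<lambda>x. f x + - g x)"
    using assms(1,2) Ck_on_add unfolding smooth_on_def by blast
  then show ?thesis by simp
qed

section \<open>Smoothness of vector- and matrix-valued maps\<close>

lemma smooth_on_vec:
  fixes f :: "'a::euclidean_space \<Rightarrow> 'b::euclidean_space^'n::finite"
  assumes "open S" "\<And>i. smooth_on S (\<lambda>x. f x $ i)"
  shows "smooth_on S f"
proof -
  have lin: "bounded_linear (axis i :: 'b \<Rightarrow> 'b^'n)" for i
    by (intro linear_conv_bounded_linear[THEN iffD1] linearI) (auto simp: axis_def vec_eq_iff)
  have "smooth_on S (\<lambda>x. \<Sum>i\<in>UNIV. axis i (f x $ i))"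
    by (intro smooth_on_sum assms(1) smooth_on_bounded_linear[OF lin] assms(2))
  moreover have "(\<Sum>i\<in>UNIV. axis i (f x $ i)) = f x" for x
    by (simp add: vec_eq_iff axis_def if_distrib cong: if_cong)
  ultimately show ?thesis by simp
qed

lemma smooth_on_nth:
  "open S \<Longrightarrow> smooth_on S f \<Longrightarrow> smooth_on S (\<lambda>x. f x $ i)"
  by (rule smooth_on_bounded_linear[OF bounded_linear_vec_nth])

lemma bounded_bilinear_matrix_vector_mult:
  "bounded_bilinear ((*v) :: real^'n^'m \<Rightarrow> real^'n \<Rightarrow> real^'m)"
  unfolding bilinear_conv_bounded_bilinear[symmetric]
  by (auto simp: bilinear_def intro!: linearI simp: algebra_simps scaleR_matrix_vector_assoc
      matrix_vector_mult_scaleR)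

lemma bounded_bilinear_matrix_matrix_mult:
  "bounded_bilinear ((**) :: real^'n^'m \<Rightarrow> real^'k^'n \<Rightarrow> real^'k^'m)"
  unfolding bilinear_conv_bounded_bilinear[symmetric]
  by (auto simp: bilinear_def intro!: linearI
      simp: vec_eq_iff matrix_matrix_mult_def algebra_simps sum.distrib sum_distrib_left)

lemma smooth_on_det:
  fixes f :: "'a::euclidean_space \<Rightarrow> real^'n^'n"
  assumes "open S" "smooth_on S f"
  shows "smooth_on S (\<lambda>x. det (f x))"
  unfolding det_def
  by (intro smooth_on_sum smooth_on_prod smooth_on_bilinear[OF bounded_bilinear_mult]
      smooth_on_const smooth_on_nth assms)

text \<open>Cramer's rule writes each entry of the inverse as a quotient of determinants, and
  determinants are polynomials in the entries.\<close>

lemma smooth_on_matrix_inv: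
  fixes f :: "'a::euclidean_space \<Rightarrow> real^'n^'n"
  assumes "open S" "smooth_on S f" "\<And>x. x \<in> S \<Longrightarrow> invertible (f x)"
  shows "smooth_on S (\<lambda>x. matrix_inv (f x))"
proof -
  have *: "smooth_on S (\<lambda>x. matrix_inv (f x) $ k $ l)" for k l
  proof (rule smooth_on_cong[OF assms(1)])
    \<comment> \<open>Column \<open>k\<close> is replaced by the \<open>l\<close>-th basis vector:
      the Cramer numerator for row \<open>k\<close> and column \<open>l\<close> of the
      inverse.\<close>
    let ?C = "\<lambda>x. \<chi> i j. if j = k then axis l (1::real) $ i else f x $ i $ j"
    show "smooth_on S (\<lambda>x. det (?C x) * inverse (det (f x)))"
    proof (intro smooth_on_bilinear[OF bounded_bilinear_mult] smooth_on_inverse smooth_on_det assms(1,2))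
      show "smooth_on S ?C"
      proof (intro smooth_on_vec assms(1))
        fix i j
        show "smooth_on S (\<lambda>x. ?C x $ i $ j)"
          by (cases "j = k") (auto intro!: smooth_on_const smooth_on_nth assms(1,2))
      qed
      show "det (f x) \<noteq> 0" if "x \<in> S" for x
        using assms(3)[OF that] by (simp add: invertible_det_nz)
    qed
    fix x assume "x \<in> S"
    then have inv: "invertible (f x)" by (rule assms(3))
    have "f x *v (matrix_inv (f x) *v axis l 1) = axis l 1"
      by (simp add: matrix_vector_mul_assoc matrix_inv_inverse[OF inv])
    then have "matrix_inv (f x) *v axis l 1 = (\<chi> k. det (\<chi> i j. if j = k then axis l 1 $ i else f x $ i $ j) / det (f x))"
      using cramer inv invertible_det_nz by blast
    then have "(matrix_inv (f x) *v axis l 1) $ k = det (?C x) / det (f x)"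
      by simp
    then show "det (?C x) * inverse (det (f x)) = matrix_inv (f x) $ k $ l"
      by (simp add: matrix_vector_mul_component cart_eq_inner_axis[symmetric] divide_inverse inner_axis)
  qed
  show ?thesis
    by (intro smooth_on_vec assms(1) *)
qed

section \<open>Total differential equations\<close>

lemma vector_derivative_chain:
  assumes "(f has_derivative F) (at (\<gamma> t))" "(\<gamma> has_vector_derivative v) (at t within T)"
  shows "((\<lambda>t. f (\<gamma> t)) has_vector_derivative F v) (at t within T)"
  using vector_derivative_diff_chain_within[OF assms(2) has_derivative_at_withinI[OF assms(1)]]
  by (simp add: o_def)

lemma vector_derivative_bound:
  fixes h :: "real \<Rightarrow> 'a::real_normed_vector"
  assumes "0 \<le> T" "\<And>t. t \<in> {0..T} \<Longrightarrow> (h has_vector_derivative h' t) (at t within {0..T})"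
    and "\<And>t. t \<in> {0..T} \<Longrightarrow> norm (h' t) \<le> B"
  shows "norm (h T - h 0) \<le> B * T"
proof -
  have "norm (h T - h 0) \<le> B * norm (T - 0)"
  proof (rule differentiable_bound[of "{0..T}" h "\<lambda>t s. s *\<^sub>R h' t"])
    show "onorm (\<lambda>s. s *\<^sub>R h' t) \<le> B" if "t \<in> {0..T}" for t
      using assms(3)[OF that] by (intro onorm_le) (simp, metis abs_ge_zero mult.commute mult_right_mono)
  qed (use assms in \<open>auto simp: has_vector_derivative_def\<close>)
  then show ?thesis using assms(1) by simp
qed

text \<open>The second difference quotient is symmetric in \<open>a\<close> and \<open>b\<close>, so that its limit is, too.\<close>

lemma symmetric_second_derivative_approx:
  fixes f :: "'a::real_normed_vector \<Rightarrow> 'b::real_normed_vector"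
  assumes W: "open W" "x \<in> W"
    and f': "\<And>y. y \<in> W \<Longrightarrow> (f has_derivative f' y) (at y)"
    and A: "((\<lambda>y. f' y a) has_derivative A) (at x)"
    and e: "0 < e"
  shows "\<exists>d>0. \<forall>s. 0 < s \<and> s < d \<longrightarrow>
    norm (f (x + s *\<^sub>R a + s *\<^sub>R b) - f (x + s *\<^sub>R a) - f (x + s *\<^sub>R b) + f x - (s * s) *\<^sub>R A b) \<le> e * (s * s)"
proof -
  \<comment> \<open>\<open>s * C\<close> bounds every displacement in the parallelogram spanned by
    \<open>s a\<close> and \<open>s b\<close>; the summand 1 keeps \<open>C\<close> positive when
    both vectors vanish. Two remainders of size \<open>e' * (s * C)\<close> occur below, whence the
    factor 2 in \<open>e'\<close>.\<close>
  define C where "C = norm a + norm b + 1"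
  have C: "C > 0" by (simp add: C_def add_nonneg_pos)
  define e' where "e' = e / (2 * C)"
  have e': "e' > 0" "2 * (e' * C) = e" using e C by (auto simp: e'_def)
  interpret A: bounded_linear A using A by (rule has_derivative_bounded_linear)
  from A e' obtain d1 where d1: "d1 > 0"
    "\<And>y. norm (y - x) < d1 \<Longrightarrow> norm (f' y a - f' x a - A (y - x)) \<le> e' * norm (y - x)"
    unfolding has_derivative_at_alt by blast
  obtain d2 where d2: "d2 > 0" "ball x d2 \<subseteq> W"
    using W open_contains_ball by blast
  define d where "d = min d1 d2 / C"
  have "d > 0" using d1 d2 C by (simp add: d_def)
  moreover have "norm (f (x + s *\<^sub>R a + s *\<^sub>R b) - f (x + s *\<^sub>R a) - f (x + s *\<^sub>R b) + f x - (s * s) *\<^sub>R A b) \<le> e * (s * s)"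
    if s: "0 < s" "s < d" for s
  proof -
    have sC: "s * C < d1" "s * C < d2"
      using s C by (auto simp: d_def field_simps)
    have small: "norm ((t * s) *\<^sub>R a + (c * s) *\<^sub>R b) \<le> s * C" if "t \<in> {0..1}" "c \<in> {0..1}" for t c
    proof -
      have "norm ((t * s) *\<^sub>R a + (c * s) *\<^sub>R b) \<le> (t * s) * norm a + (c * s) * norm b"
        using that s by (intro norm_triangle_le) (simp add: abs_mult)
      also have "\<dots> \<le> s * norm a + s * norm b"
        using that s by (intro add_mono mult_right_mono) (auto intro: mult_left_le_one_le)
      also have "\<dots> \<le> s * C" using s by (simp add: C_def algebra_simps)
      finally show ?thesis .
    qed
    define p where "p t c = x + ((t * s) *\<^sub>R a + (c * s) *\<^sub>R b)" for t c
    have pW: "p t c \<in> W" if "t \<in> {0..1}" "c \<in> {0..1}" for t c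
    proof -
      have "dist (p t c) x < d2" using small[OF that] sC by (simp add: p_def dist_norm)
      then show ?thesis using d2(2) by (auto simp: dist_commute)
    qed
    have est: "norm (f' (p t c) a - f' x a - A ((t * s) *\<^sub>R a + (c * s) *\<^sub>R b)) \<le> e' * (s * C)"
      if "t \<in> {0..1}" "c \<in> {0..1}" for t c
    proof -
      have "norm (p t c - x) < d1" using small[OF that] sC by (simp add: p_def)
      from d1(2)[OF this] show ?thesis
        using small[OF that] e' by (auto simp: p_def intro: order_trans mult_left_mono)
    qed
    \<comment> \<open>The increment of \<open>f\<close> across the parallelogram at position
      \<open>t\<close> along \<open>a\<close>, less its expected linear growth, so that
      \<open>h 1 - h 0\<close> is the quantity to be bounded. The constant \<open>f' x a\<close>
      drops out of \<open>h'\<close> as a difference of two expansions at \<open>x\<close>.\<close>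
    define h where "h t = f (p t 1) - f (p t 0) - (t * (s * s)) *\<^sub>R A b" for t
    define h' where "h' t = f' (p t 1) (s *\<^sub>R a) - f' (p t 0) (s *\<^sub>R a) - (s * s) *\<^sub>R A b" for t
    have dp: "((\<lambda>t. p t c) has_vector_derivative s *\<^sub>R a) (at t within {0..1})" for t c
      unfolding p_def by (auto intro!: derivative_eq_intros)
    have dh: "(h has_vector_derivative h' t) (at t within {0..1})" if "t \<in> {0..1}" for t
      unfolding h_def h'_def
      by (intro has_vector_derivative_diff vector_derivative_chain[OF f' dp] pW that)
        (auto intro!: derivative_eq_intros)
    have "norm (h' t) \<le> e * (s * s)" if t: "t \<in> {0..1}" for t
    proof -
      have l: "f' (p t c) (s *\<^sub>R a) = s *\<^sub>R f' (p t c) a" if "c \<in> {0..1}" for c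
        using linear_scale[OF has_derivative_linear[OF f'[OF pW[OF t that]]]] .
      define X where "X c = f' (p t c) a - f' x a - A ((t * s) *\<^sub>R a + (c * s) *\<^sub>R b)" for c
      have "h' t = s *\<^sub>R (X 1 - X 0)"
        by (simp add: h'_def X_def l A.add A.scaleR algebra_simps)
      then have "norm (h' t) = s * norm (X 1 - X 0)" using s by simp
      also have "\<dots> \<le> s * (e' * (s * C) + e' * (s * C))"
        using s est[OF t, of 1] est[OF t, of 0] by (intro mult_left_mono order_trans[OF norm_triangle_ineq4] add_mono) (auto simp: X_def)
      also have "\<dots> = (2 * (e' * C)) * (s * s)" by (simp add: algebra_simps)
      finally show ?thesis by (simp only: e'(2))
    qed
    from vector_derivative_bound[OF _ dh this] have "norm (h 1 - h 0) \<le> e * (s * s)" by simp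
    then show ?thesis by (simp add: h_def p_def algebra_simps)
  qed
  ultimately show ?thesis by blast
qed

lemma symmetric_second_derivative:
  fixes f :: "'a::real_normed_vector \<Rightarrow> 'b::real_normed_vector"
  assumes W: "open W" "x \<in> W"
    and f': "\<And>y. y \<in> W \<Longrightarrow> (f has_derivative f' y) (at y)"
    and A: "((\<lambda>y. f' y a) has_derivative A) (at x)"
    and B: "((\<lambda>y. f' y b) has_derivative B) (at x)"
  shows "A b = B a"
proof -
  have "norm (A b - B a) \<le> 0 + e" if "e > 0" for e
  proof -
    have e2: "e / 2 > 0" using that by simp
    obtain d where d: "d > 0" "\<And>s. 0 < s \<and> s < d \<Longrightarrow>
      norm (f (x + s *\<^sub>R a + s *\<^sub>R b) - f (x + s *\<^sub>R a) - f (x + s *\<^sub>R b) + f x - (s * s) *\<^sub>R A b) \<le> e / 2 * (s * s)"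
      using symmetric_second_derivative_approx[OF W f' A e2] by blast
    obtain d' where d': "d' > 0" "\<And>s. 0 < s \<and> s < d' \<Longrightarrow>
      norm (f (x + s *\<^sub>R b + s *\<^sub>R a) - f (x + s *\<^sub>R b) - f (x + s *\<^sub>R a) + f x - (s * s) *\<^sub>R B a) \<le> e / 2 * (s * s)"
      using symmetric_second_derivative_approx[OF W f' B e2] by blast
    define s where "s = min d d' / 2"
    have s: "0 < s" "s < d" "s < d'" using d(1) d'(1) by (auto simp: s_def)
    define u where "u = f (x + s *\<^sub>R a + s *\<^sub>R b) - f (x + s *\<^sub>R a) - f (x + s *\<^sub>R b) + f x"
    have "norm (u - (s * s) *\<^sub>R A b) \<le> e / 2 * (s * s)" "norm (u - (s * s) *\<^sub>R B a) \<le> e / 2 * (s * s)"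
      using d(2)[of s] d'(2)[of s] s by (auto simp: u_def algebra_simps)
    then have "norm ((s * s) *\<^sub>R A b - (s * s) *\<^sub>R B a) \<le> e / 2 * (s * s) + e / 2 * (s * s)"
      by (intro norm_diff_triangle_le[of _ u]) (auto simp: norm_minus_commute)
    also have "(s * s) *\<^sub>R A b - (s * s) *\<^sub>R B a = (s * s) *\<^sub>R (A b - B a)"
      by (simp add: scaleR_diff_right)
    finally have "(s * s) * norm (A b - B a) \<le> (s * s) * e" by (simp add: mult_ac)
    then show ?thesis using s by (simp add: mult_le_cancel_left)
  qed
  then have "norm (A b - B a) \<le> 0" by (rule field_le_epsilon)
  then show ?thesis by simp
qed

text \<open>This plays the part of Gronwall's inequality. If \<open>m\<close> is the maximum of
  \<open>norm (\<phi> t)\<close>, the derivative is bounded by \<open>m / 2 + B\<close> on an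
  interval of length 1, so the mean value inequality gives \<open>m \<le> m / 2 + B\<close>.\<close>

lemma self_bounded_derivative:
  fixes \<phi> :: "real \<Rightarrow> 'a::real_normed_vector"
  assumes "\<phi> 0 = 0"
    and der: "\<And>t. t \<in> {0..1} \<Longrightarrow> (\<phi> has_vector_derivative \<phi>' t) (at t within {0..1})"
    and bd: "\<And>t. t \<in> {0..1} \<Longrightarrow> norm (\<phi>' t) \<le> k * norm (\<phi> t) + B"
    and k: "0 \<le> k" "k \<le> 1 / 2" and t: "t \<in> {0..1}"
  shows "norm (\<phi> t) \<le> 2 * B"
proof -
  have "continuous_on {0..1} (\<lambda>t. norm (\<phi> t))"
    by (intro continuous_on_norm continuous_on_vector_derivative[OF der])
  then obtain t0 where t0: "t0 \<in> {0..1}" "\<And>t. t \<in> {0..1} \<Longrightarrow> norm (\<phi> t) \<le> norm (\<phi> t0)"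
    using continuous_attains_sup[of "{0..1::real}" "\<lambda>t. norm (\<phi> t)"] by auto
  define m where "m = norm (\<phi> t0)"
  have bd': "norm (\<phi>' t) \<le> m / 2 + B" if "t \<in> {0..1}" for t
  proof -
    have "k * norm (\<phi> t) \<le> (1 / 2) * m"
      using k t0(2)[OF that] by (intro mult_mono) (auto simp: m_def)
    with bd[OF that] show ?thesis by simp
  qed
  have "0 \<le> m / 2 + B" using order_trans[OF norm_ge_zero bd'[OF t]] .
  have "norm (\<phi> t0 - \<phi> 0) \<le> (m / 2 + B) * t0"
  proof (rule vector_derivative_bound[where h' = \<phi>'])
    show "(\<phi> has_vector_derivative \<phi>' s) (at s within {0..t0})" if "s \<in> {0..t0}" for s
      using t0(1) that by (intro has_vector_derivative_within_subset[OF der]) auto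
  qed (use t0(1) bd' in auto)
  also have "\<dots> \<le> m / 2 + B"
    using t0(1) \<open>0 \<le> m / 2 + B\<close> by (simp add: mult_left_le)
  finally have "m \<le> 2 * B" using assms(1) by (simp add: m_def)
  then show ?thesis using t0(2)[OF t] by (simp add: m_def)
qed

text \<open>The equation to be solved is \<open>Df(w) a = S (f w) a\<close>, with \<open>S'\<close>
  the derivative of \<open>S\<close> in the point. Differentiating the right-hand side once more
  along a solution gives \<open>S' x (S x a) b\<close>, so \<open>integrability\<close> is the
  equality of mixed second derivatives that a twice differentiable solution forces. All bounds share
  one constant \<open>K\<close>, and the quadratic Taylor remainder stands in for a bound on second
  derivatives.\<close>

locale total_differential =
  fixes S :: "'a::euclidean_space \<Rightarrow> 'b::euclidean_space \<Rightarrow> 'a"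
    and S' :: "'a \<Rightarrow> 'a \<Rightarrow> 'b \<Rightarrow> 'a"
    and x0 :: 'a and \<rho> K :: real
  assumes \<rho>: "\<rho> > 0" and K: "K > 0"
    and lin: "\<And>x. x \<in> cball x0 \<rho> \<Longrightarrow> linear (S x)"
    and der: "\<And>x a. x \<in> cball x0 \<rho> \<Longrightarrow> ((\<lambda>y. S y a) has_derivative (\<lambda>u. S' x u a)) (at x)"
    and bound: "\<And>x a. x \<in> cball x0 \<rho> \<Longrightarrow> norm (S x a) \<le> K * norm a"
    and lipschitz: "\<And>x y a. x \<in> cball x0 \<rho> \<Longrightarrow> y \<in> cball x0 \<rho> \<Longrightarrow>
      norm (S x a - S y a) \<le> K * norm (x - y) * norm a"
    and bound': "\<And>x u a. x \<in> cball x0 \<rho> \<Longrightarrow> norm (S' x u a) \<le> K * norm u * norm a"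
    and taylor: "\<And>x y a. x \<in> cball x0 \<rho> \<Longrightarrow> y \<in> cball x0 \<rho> \<Longrightarrow>
      norm (S y a - S x a - S' x (y - x) a) \<le> K * (norm (y - x))\<^sup>2 * norm a"
    and integrability: "\<And>x a b. x \<in> cball x0 \<rho> \<Longrightarrow> S' x (S x a) b = S' x (S x b) a"
begin

text \<open>Continuity in the point is available only for a fixed argument; linearity in the
  argument and a basis expansion give joint continuity.\<close>

lemma continuous_on_S:
  assumes "continuous_on X \<phi>" "\<phi> ` X \<subseteq> cball x0 \<rho>" "continuous_on X \<psi>"
  shows "continuous_on X (\<lambda>z. S (\<phi> z) (\<psi> z))"
proof -
  have "continuous_on (cball x0 \<rho>) (\<lambda>y. S y a)" for a
    by (rule has_derivative_continuous_on[OF has_derivative_at_withinI[OF der]])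
  then have "continuous_on X (\<lambda>z. S (\<phi> z) a)" for a
    by (rule continuous_on_compose2[OF _ assms(1,2)])
  then have "continuous_on X (\<lambda>z. \<Sum>b\<in>Basis. (\<psi> z \<bullet> b) *\<^sub>R S (\<phi> z) b)"
    by (intro continuous_intros assms(3))
  also have "?this \<longleftrightarrow> ?thesis"
  proof (intro continuous_on_cong refl)
    fix z assume "z \<in> X"
    then interpret linear "S (\<phi> z)" using assms(2) by (intro lin) auto
    show "(\<Sum>b\<in>Basis. (\<psi> z \<bullet> b) *\<^sub>R S (\<phi> z) b) = S (\<phi> z) (\<psi> z)"
      by (subst euclidean_representation[of "\<psi> z", symmetric]) (simp only: sum scaleR)
  qed
  finally show ?thesis .
qed

text \<open>The projection \<open>\<pi>\<close> onto the ball makes the Picard operator act on functions defined everywhere,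
  as the type of bounded continuous functions requires.\<close>

lemma radial_fixed_point:
  assumes r: "r > 0" "K * r \<le> 1 / 2" "K * r \<le> \<rho>"
  shows "\<exists>f. continuous_on (cball 0 r) f \<and> f ` cball 0 r \<subseteq> cball x0 \<rho> \<and>
    (\<forall>w\<in>cball 0 r. f w = x0 + integral {0..1} (\<lambda>t. S (f (t *\<^sub>R w)) w))"
proof -
  define \<pi> :: "'b \<Rightarrow> 'b" where "\<pi> = closest_point (cball 0 r)"
  have \<pi>: "norm (\<pi> w) \<le> r" for w
    using closest_point_in_set[of "cball 0 r" w] r by (simp add: \<pi>_def)
  have \<pi>_self: "\<pi> w = w" if "norm w \<le> r" for w
    using that by (simp add: \<pi>_def closest_point_self)
  have cont_\<pi>: "continuous_on X \<pi>" for X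
    unfolding \<pi>_def using r by (intro continuous_on_closest_point) auto
  define X :: "('b \<Rightarrow>\<^sub>C 'a) set" where "X = PiC UNIV (\<lambda>_. cball x0 \<rho>)"
  have X: "u \<in> X \<longleftrightarrow> (\<forall>w. apply_bcontfun u w \<in> cball x0 \<rho>)" for u
    by (auto simp: X_def mem_PiC_iff)
  define T where "T u w = x0 + integral {0..1} (\<lambda>t. S (apply_bcontfun u (t *\<^sub>R \<pi> w)) (\<pi> w))" for u w
  have cont: "continuous_on Y (\<lambda>z. S (apply_bcontfun u (\<phi> z)) (\<psi> z))"
    if "u \<in> X" "continuous_on Y \<phi>" "continuous_on Y \<psi>" for u \<phi> \<psi> and Y :: "'c::topological_space set"
    using that X continuous_on_compose2[OF continuous_on_apply_bcontfun[of UNIV u] that(2)]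
    by (intro continuous_on_S) auto
  have bnd: "norm (T u w - x0) \<le> \<rho>" if u: "u \<in> X" for u w
  proof -
    have "norm (integral {0..1} (\<lambda>t. S (apply_bcontfun u (t *\<^sub>R \<pi> w)) (\<pi> w))) \<le> (K * r) * (1 - 0)"
    proof (rule integral_bound)
      show "norm (S (apply_bcontfun u (t *\<^sub>R \<pi> w)) (\<pi> w)) \<le> K * r" for t
        using u X K \<pi>[of w] by (auto intro!: order_trans[OF bound] mult_left_mono)
    qed (auto intro!: cont[OF u] continuous_intros)
    then show ?thesis using r by (simp add: T_def)
  qed
  have TB: "T u \<in> bcontfun" if u: "u \<in> X" for u
  proof (rule bcontfun_normI)
    have "continuous_on (UNIV \<times> cbox 0 (1::real)) (\<lambda>(w, t). S (apply_bcontfun u (t *\<^sub>R \<pi> w)) (\<pi> w))"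
      unfolding case_prod_unfold
      by (intro cont[OF u] continuous_intros continuous_on_compose2[OF cont_\<pi>]) auto
    from integral_continuous_on_param[OF this] show "continuous_on UNIV (T u)"
      unfolding T_def by (intro continuous_intros) simp
    show "norm (T u w) \<le> norm x0 + \<rho>" for w
      using norm_triangle_sub[of "T u w" x0] bnd[OF u, of w] by simp
  qed
  have app: "apply_bcontfun (Bcontfun (T u)) = T u" if "u \<in> X" for u
    using TB[OF that] by (rule Bcontfun_inverse)
  \<comment> \<open>The bound \<open>K * r \<le> \<rho>\<close> keeps the image in the ball, and
    \<open>K * r \<le> 1 / 2\<close> is the contraction factor.\<close>
  have "\<exists>!u\<in>X. Bcontfun (T u) = u"
  proof (rule Banach_fix[where c = "1 / 2"])
    show "complete X"
      unfolding X_def complete_eq_closed by (intro closed_PiC closed_cball)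
    show "X \<noteq> {}"
      using X[of "const_bcontfun x0"] \<rho> by (auto simp: const_bcontfun.rep_eq)
    show "(\<lambda>u. Bcontfun (T u)) ` X \<subseteq> X"
      using bnd by (auto simp: X app dist_norm norm_minus_commute)
    fix u v assume u: "u \<in> X" and v: "v \<in> X"
    show "dist (Bcontfun (T u)) (Bcontfun (T v)) \<le> 1 / 2 * dist u v"
    proof (rule dist_bound)
      fix w
      let ?F = "\<lambda>u t. S (apply_bcontfun u (t *\<^sub>R \<pi> w)) (\<pi> w)"
      have c: "continuous_on {0..1} (?F u)" if "u \<in> X" for u
        by (auto intro!: cont[OF that] continuous_intros)
      have "T u w - T v w = integral {0..1} (\<lambda>t. ?F u t - ?F v t)"
        by (simp add: T_def integral_diff integrable_continuous_real c u v)
      also have "norm \<dots> \<le> (1 / 2 * dist u v) * (1 - 0)"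
      proof (rule integral_bound)
        fix t
        have "norm (?F u t - ?F v t) \<le> K * norm (apply_bcontfun u (t *\<^sub>R \<pi> w) - apply_bcontfun v (t *\<^sub>R \<pi> w)) * norm (\<pi> w)"
          using u v X by (intro lipschitz) auto
        also have "\<dots> \<le> K * dist u v * r"
          using dist_bounded[of u "t *\<^sub>R \<pi> w" v] \<pi>[of w] K
          by (intro mult_mono) (auto simp: dist_norm)
        also have "\<dots> = (K * r) * dist u v" by simp
        also have "\<dots> \<le> 1 / 2 * dist u v" using r by (intro mult_right_mono) auto
        finally show "norm (?F u t - ?F v t) \<le> 1 / 2 * dist u v" .
      qed (auto intro!: continuous_intros c u v)
      finally show "dist (apply_bcontfun (Bcontfun (T u)) w) (apply_bcontfun (Bcontfun (T v)) w) \<le> 1 / 2 * dist u v"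
        by (simp add: app u v dist_norm)
    qed
  qed auto
  then obtain u where u: "u \<in> X" "Bcontfun (T u) = u" by blast
  have eq: "apply_bcontfun u w = T u w" for w using app[OF u(1)] u(2) by simp
  have "T u w = x0 + integral {0..1} (\<lambda>t. S (apply_bcontfun u (t *\<^sub>R w)) w)"
    if "w \<in> cball 0 r" for w using that by (simp add: T_def \<pi>_self)
  then have "apply_bcontfun u w = x0 + integral {0..1} (\<lambda>t. S (apply_bcontfun u (t *\<^sub>R w)) w)"
    if "w \<in> cball 0 r" for w using that by (subst eq)
  moreover have "apply_bcontfun u ` cball 0 r \<subseteq> cball x0 \<rho>" using u(1) X by auto
  ultimately show ?thesis using continuous_on_apply_bcontfun by blast
qed

text \<open>Rescaling the integration variable turns the integral over the unit interval at the
  point \<open>s w\<close> into the integral over \<open>{0..s}\<close> along the ray of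
  \<open>w\<close>. On a ray, \<open>f\<close> is thus an integral with variable upper
  limit.\<close>

lemma radial_derivative:
  assumes f: "continuous_on (cball 0 r) f" "f ` cball 0 r \<subseteq> cball x0 \<rho>"
    and fix_f: "\<And>w. w \<in> cball 0 r \<Longrightarrow> f w = x0 + integral {0..1} (\<lambda>t. S (f (t *\<^sub>R w)) w)"
    and w: "w \<in> cball 0 r" and t: "t \<in> {0..1}"
  shows "((\<lambda>t. f (t *\<^sub>R w)) has_vector_derivative S (f (t *\<^sub>R w)) w) (at t within {0..1})"
proof -
  have tw: "s *\<^sub>R w \<in> cball 0 r" if "s \<in> {0..1}" for s
    using w that mult_mono[of s 1 "norm w" r] by simp
  define I where "I s = integral {0..s} (\<lambda>t. S (f (t *\<^sub>R w)) w)" for s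
  have "continuous_on {0..1} (\<lambda>t. S (f (t *\<^sub>R w)) w)"
    using tw f by (intro continuous_on_S continuous_on_compose2[OF f(1)] continuous_intros) auto
  then have dI: "(I has_vector_derivative S (f (s *\<^sub>R w)) w) (at s within {0..1})" if "s \<in> {0..1}" for s
    unfolding I_def using that by (rule integral_has_vector_derivative)
  have "f (s *\<^sub>R w) = x0 + I s" if s: "s \<in> {0..1}" for s
  proof -
    \<comment> \<open>The substitution is made by differentiating \<open>I (t * s)\<close> in
      \<open>t\<close>, which avoids dividing by \<open>s\<close> and so includes
      \<open>s = 0\<close>.\<close>
    have "((\<lambda>t. S (f (t *\<^sub>R (s *\<^sub>R w))) (s *\<^sub>R w)) has_integral (I (1 * s) - I (0 * s))) {0..1}"
    proof (rule fundamental_theorem_of_calculus)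
      fix t :: real assume t: "t \<in> {0..1}"
      then have ts: "t * s \<in> {0..1}" using s by (auto intro: mult_le_one)
      have "(\<lambda>t. t * s) ` {0..1} \<subseteq> {0..1}" using s by (auto intro: mult_le_one)
      then have "(I has_vector_derivative S (f ((t * s) *\<^sub>R w)) w) (at (t * s) within (\<lambda>t. t * s) ` {0..1})"
        using has_vector_derivative_within_subset[OF dI[OF ts]] by blast
      then have "((I \<circ> (\<lambda>t. t * s)) has_vector_derivative s *\<^sub>R S (f ((t * s) *\<^sub>R w)) w) (at t within {0..1})"
        by (intro vector_diff_chain_within) (auto intro!: derivative_eq_intros)
      moreover have "S (f ((t * s) *\<^sub>R w)) (s *\<^sub>R w) = s *\<^sub>R S (f ((t * s) *\<^sub>R w)) w"
        by (rule linear_scale[OF lin[OF subsetD[OF f(2) imageI[OF tw[OF ts]]]]])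
      ultimately show "((\<lambda>t. I (t * s)) has_vector_derivative S (f (t *\<^sub>R s *\<^sub>R w)) (s *\<^sub>R w)) (at t within {0..1})"
        by (simp add: o_def)
    qed simp
    moreover have "I 0 = 0" by (simp add: I_def)
    ultimately have "I s = integral {0..1} (\<lambda>t. S (f (t *\<^sub>R (s *\<^sub>R w))) (s *\<^sub>R w))"
      by (simp add: integral_unique)
    then show ?thesis using fix_f[OF tw[OF s]] by simp
  qed
  moreover have "((\<lambda>s. x0 + I s) has_vector_derivative S (f (t *\<^sub>R w)) w) (at t within {0..1})"
    using dI[OF t] by (auto intro!: derivative_eq_intros)
  ultimately show ?thesis
    by (rule has_vector_derivative_transform[OF t])
qed

text \<open>The estimate behind differentiability: \<open>G(t) = f(t(x+h)) - f(tx) - t S(f(tx)) h\<close> satisfies, by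
  integrability, \<open>|G'| \<le> K r |G| + O(|h|\<^sup>2)\<close>.\<close>

lemma second_order_estimate:
  assumes r: "r > 0" "K * r \<le> 1 / 2"
    and f: "f ` cball 0 r \<subseteq> cball x0 \<rho>"
    and radial: "\<And>w t. w \<in> cball 0 r \<Longrightarrow> t \<in> {0..1} \<Longrightarrow>
      ((\<lambda>t. f (t *\<^sub>R w)) has_vector_derivative S (f (t *\<^sub>R w)) w) (at t within {0..1})"
    and x: "x \<in> cball 0 r" and y: "x + h \<in> cball 0 r"
  shows "norm (f (x + h) - f x - S (f x) h) \<le> 8 * K\<^sup>2 * (norm h)\<^sup>2"
proof -
  define p where "p t = f (t *\<^sub>R x)" for t :: real
  define q where "q t = f (t *\<^sub>R (x + h))" for t :: real
  have tw: "t *\<^sub>R w \<in> cball 0 r" if "t \<in> {0..1}" "w \<in> cball 0 r" for t and w :: 'b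
    using that mult_mono[of t 1 "norm w" r] by simp
  have pq: "p t \<in> cball x0 \<rho>" "q t \<in> cball x0 \<rho>" if "t \<in> {0..1}" for t
    using tw[OF that] x y f unfolding p_def q_def by blast+
  have dp: "(p has_vector_derivative S (p t) x) (at t within {0..1})"
    and dq: "(q has_vector_derivative S (q t) (x + h)) (at t within {0..1})" if "t \<in> {0..1}" for t
    using radial[OF x that] radial[OF y that] by (simp_all add: p_def[abs_def] q_def[abs_def])
  have nx: "norm x \<le> r" "norm (x + h) \<le> r" using x y by auto
  have Sq: "S (q t) (x + h) = S (q t) x + S (q t) h" if "t \<in> {0..1}" for t
    using linear_add[OF lin[OF pq(2)[OF that]]] .
  define \<phi> where "\<phi> t = q t - p t" for t
  \<comment> \<open>Neighbouring rays separate at most linearly in \<open>h\<close>; this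
    first-order bound makes the Taylor remainder in the estimate of \<open>G'\<close>
    quadratic.\<close>
  have \<phi>: "norm (\<phi> t) \<le> 2 * (K * norm h)" if t: "t \<in> {0..1}" for t
  proof (rule self_bounded_derivative[where \<phi>' = "\<lambda>t. S (q t) (x + h) - S (p t) x" and k = "K * r"])
    show "\<phi> 0 = 0" by (simp add: \<phi>_def p_def q_def)
    fix t :: real assume t: "t \<in> {0..1}"
    show "(\<phi> has_vector_derivative S (q t) (x + h) - S (p t) x) (at t within {0..1})"
      unfolding \<phi>_def by (intro has_vector_derivative_diff dp dq t)
    have "S (q t) (x + h) - S (p t) x = (S (q t) x - S (p t) x) + S (q t) h"
      by (simp add: Sq[OF t])
    also have "norm \<dots> \<le> K * norm (q t - p t) * norm x + K * norm h"
      by (intro norm_triangle_mono lipschitz bound pq t)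
    also have "\<dots> \<le> K * norm (q t - p t) * r + K * norm h"
      using nx K by (intro add_right_mono mult_left_mono) auto
    finally show "norm (S (q t) (x + h) - S (p t) x) \<le> K * r * norm (\<phi> t) + K * norm h"
      by (simp add: \<phi>_def mult_ac)
  qed (use r K t in auto)
  define G where "G t = \<phi> t - t *\<^sub>R S (p t) h" for t
  define G' where "G' t = S (q t) (x + h) - S (p t) x - (t *\<^sub>R S' (p t) (S (p t) x) h + S (p t) h)" for t
  \<comment> \<open>In the bound for \<open>G'\<close> the Lipschitz term contributes
    \<open>2 * K\<^sup>2\<close>, and the Taylor term as much again because
    \<open>K * r \<le> 1 / 2\<close>. Absorbing the term in \<open>G\<close> doubles the sum, which
    gives the constant 8.\<close>
  have "norm (G 1) \<le> 2 * (4 * K\<^sup>2 * (norm h)\<^sup>2)"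
  proof (rule self_bounded_derivative[where \<phi>' = G' and k = "K * r"])
    show "G 0 = 0" by (simp add: G_def \<phi>_def p_def q_def)
    fix t :: real assume t: "t \<in> {0..1}"
    have "((\<lambda>t. S (p t) h) has_vector_derivative S' (p t) (S (p t) x) h) (at t within {0..1})"
      by (rule vector_derivative_chain[OF der[OF pq(1)[OF t]] dp[OF t]])
    from has_vector_derivative_scaleR[OF DERIV_ident this]
    have "((\<lambda>t. t *\<^sub>R S (p t) h) has_vector_derivative t *\<^sub>R S' (p t) (S (p t) x) h + S (p t) h) (at t within {0..1})"
      by simp
    then show "(G has_vector_derivative G' t) (at t within {0..1})"
      unfolding G_def G'_def \<phi>_def by (intro has_vector_derivative_diff dp dq t)
    have lin': "linear (\<lambda>u. S' (p t) u a)" for a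
      by (rule has_derivative_linear[OF der[OF pq(1)[OF t]]])
    have "S' (p t) (G t) x = S' (p t) (\<phi> t) x - t *\<^sub>R S' (p t) (S (p t) h) x"
      by (simp add: G_def linear_diff[OF lin'] linear_scale[OF lin'])
    \<comment> \<open>The sole appeal to integrability: exchanging \<open>h\<close> and
      \<open>x\<close> produces exactly the term that comes from differentiating
      \<open>t *\<^sub>R S (p t) h\<close>. What then remains of \<open>G'\<close> is linear in
      \<open>G\<close> up to quadratic errors.\<close>
    also have "S' (p t) (S (p t) h) x = S' (p t) (S (p t) x) h"
      by (rule integrability[OF pq(1)[OF t]])
    finally have "G' t = ((S (q t) h - S (p t) h) + (S (q t) x - S (p t) x - S' (p t) (q t - p t) x))
        + S' (p t) (G t) x"
      by (simp add: G'_def Sq[OF t] \<phi>_def)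
    then have "norm (G' t) \<le> K * norm (\<phi> t) * norm h + K * (norm (\<phi> t))\<^sup>2 * norm x + K * norm (G t) * norm x"
      unfolding \<phi>_def by (simp only:) (intro norm_triangle_mono lipschitz taylor bound' pq t)
    also have "\<dots> \<le> K * (2 * (K * norm h)) * norm h + K * (2 * (K * norm h))\<^sup>2 * r + K * norm (G t) * r"
      using K nx \<phi>[OF t] r by (intro add_mono mult_mono power_mono) auto
    also have "K * (2 * (K * norm h))\<^sup>2 * r = (K * r) * (4 * K\<^sup>2 * (norm h)\<^sup>2)"
      by (simp add: power2_eq_square)
    also have "\<dots> \<le> (1 / 2) * (4 * K\<^sup>2 * (norm h)\<^sup>2)"
      using r by (intro mult_right_mono) auto
    finally show "norm (G' t) \<le> K * r * norm (G t) + 4 * K\<^sup>2 * (norm h)\<^sup>2"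
      by (simp add: power2_eq_square algebra_simps)
  qed (use r K in auto)
  then show ?thesis by (simp add: G_def \<phi>_def p_def q_def)
qed

text \<open>The second-order estimate holds for any two points of the ball, so it gives the
  derivative at every interior point and not only at the centre of the rays.\<close>

theorem total_differential_solution:
  "\<exists>r>0. \<exists>f. f 0 = x0 \<and> (\<forall>w\<in>ball 0 r. f w \<in> cball x0 \<rho> \<and> (f has_derivative S (f w)) (at w))"
proof -
  \<comment> \<open>The largest radius with \<open>K * r \<le> 1 / 2\<close> and
    \<open>K * r \<le> \<rho>\<close>.\<close>
  define r where "r = min (1 / 2) \<rho> / K"
  have r: "r > 0" "K * r \<le> 1 / 2" "K * r \<le> \<rho>" using \<rho> K by (auto simp: r_def)
  obtain f where f: "continuous_on (cball 0 r) f" "f ` cball 0 r \<subseteq> cball x0 \<rho>"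
    and fix_f: "\<And>w. w \<in> cball 0 r \<Longrightarrow> f w = x0 + integral {0..1} (\<lambda>t. S (f (t *\<^sub>R w)) w)"
    using radial_fixed_point[OF r] by blast
  note est = second_order_estimate[OF r(1,2) f(2) radial_derivative[OF f fix_f]]
  have "f 0 = x0"
    using fix_f[of 0] r linear_0[OF lin[of "f 0"]] f(2) by (auto simp: image_subset_iff)
  moreover have "(f has_derivative S (f w)) (at w)" if w: "w \<in> ball 0 r" for w
    unfolding has_derivative_at_alt
  proof (intro conjI allI impI)
    have fw: "f w \<in> cball x0 \<rho>" using w f(2) by (auto simp: image_subset_iff)
    then show "bounded_linear (S (f w))"
      using lin linear_conv_bounded_linear by blast
    fix e :: real assume e: "e > 0"
    obtain d where d: "d > 0" "ball w d \<subseteq> ball 0 r"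
      using w open_ball open_contains_ball by blast
    define d' where "d' = min d (e / (8 * K\<^sup>2))"
    have "norm (f y - f w - S (f w) (y - w)) \<le> e * norm (y - w)" if y: "norm (y - w) < d'" for y
    proof -
      have "y \<in> ball w d" using y by (simp add: d'_def dist_norm norm_minus_commute)
      then have "y \<in> ball 0 r" using d(2) by blast
      then have "norm (f (w + (y - w)) - f w - S (f w) (y - w)) \<le> 8 * K\<^sup>2 * (norm (y - w))\<^sup>2"
        using w by (intro est) auto
      also have "\<dots> = (norm (y - w) * (8 * K\<^sup>2)) * norm (y - w)" by (simp add: power2_eq_square)
      also have "\<dots> \<le> e * norm (y - w)"
        using y K by (intro mult_right_mono) (auto simp: d'_def pos_less_divide_eq)
      finally show ?thesis by simp
    qed
    moreover have "d' > 0" using d e K by (simp add: d'_def)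
    ultimately show "\<exists>d>0. \<forall>y. norm (y - w) < d \<longrightarrow> norm (f y - f w - S (f w) (y - w)) \<le> e * norm (y - w)"
      by blast
  qed
  moreover have "f w \<in> cball x0 \<rho>" if "w \<in> ball 0 r" for w using that f(2) by (auto simp: image_subset_iff)
  ultimately show ?thesis using r(1) by blast
qed

end

section \<open>Frobenius' theorem for the kernel of a matrix field\<close>

text \<open>Smoothness as defined controls derivatives in one fixed direction at a time. This passes
  from the finitely many basis directions to a bound uniform in the direction.\<close>

lemma norm_linear_le_Basis:
  fixes h :: "'a::euclidean_space \<Rightarrow> 'b::real_normed_vector"
  assumes "linear h" "\<And>b. b \<in> Basis \<Longrightarrow> norm (h b) \<le> C b"
  shows "norm (h u) \<le> (\<Sum>b\<in>Basis. C b) * norm u"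
proof -
  interpret linear h by fact
  have "h u = (\<Sum>b\<in>Basis. (u \<bullet> b) *\<^sub>R h b)"
    by (subst euclidean_representation[of u, symmetric]) (simp only: sum scaleR)
  also have "norm \<dots> \<le> (\<Sum>b\<in>Basis. norm u * C b)"
    by (intro sum_norm_le) (auto intro!: mult_mono assms(2) Basis_le_norm)
  finally show ?thesis by (simp add: sum_distrib_left mult.commute)
qed

lemma smooth_on_cball_bounded:
  fixes h :: "'a::euclidean_space \<Rightarrow> 'b::real_normed_vector"
  assumes "smooth_on V h" "cball x0 \<rho> \<subseteq> V"
  obtains C where "C \<ge> 0" "\<And>x. x \<in> cball x0 \<rho> \<Longrightarrow> norm (h x) \<le> C"
proof -
  have "compact (h ` cball x0 \<rho>)"
    by (intro compact_continuous_image continuous_on_subset[OF smooth_on_imp_continuous_on[OF assms(1)] assms(2)]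
        compact_cball)
  then obtain C where "\<forall>y\<in>h ` cball x0 \<rho>. norm y \<le> C"
    using compact_imp_bounded bounded_iff by blast
  then have "norm (h x) \<le> max C 0" if "x \<in> cball x0 \<rho>" for x
    using that by (auto simp: le_max_iff_disj)
  then show ?thesis by (intro that[of "max C 0"]) auto
qed

lemma smooth_on_cball_derivative_bounded:
  fixes h :: "'a::euclidean_space \<Rightarrow> 'b::real_normed_vector"
  assumes "smooth_on V h" "cball x0 \<rho> \<subseteq> V"
  obtains C where "C \<ge> 0"
    "\<And>x u. x \<in> cball x0 \<rho> \<Longrightarrow> norm (frechet_derivative h (at x) u) \<le> C * norm u"
    "\<And>x y. x \<in> cball x0 \<rho> \<Longrightarrow> y \<in> cball x0 \<rho> \<Longrightarrow> norm (h x - h y) \<le> C * norm (x - y)"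
proof -
  have "\<exists>C\<ge>0. \<forall>x\<in>cball x0 \<rho>. norm (frechet_derivative h (at x) b) \<le> C" for b
    using smooth_on_cball_bounded[OF smooth_on_frechet_derivative[OF assms(1)] assms(2)] by metis
  then obtain C where C: "\<And>b. C b \<ge> 0"
    "\<And>b x. x \<in> cball x0 \<rho> \<Longrightarrow> norm (frechet_derivative h (at x) b) \<le> C b"
    by metis
  define c where "c = (\<Sum>b\<in>Basis. C b)"
  have der: "(h has_derivative frechet_derivative h (at x)) (at x)" if "x \<in> cball x0 \<rho>" for x
    using assms that by (intro smooth_on_has_derivative[OF assms(1)]) auto
  have le: "norm (frechet_derivative h (at x) u) \<le> c * norm u" if "x \<in> cball x0 \<rho>" for x u
    unfolding c_def by (rule norm_linear_le_Basis[OF has_derivative_linear[OF der] C(2)]) (rule that)+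
  have "norm (h x - h y) \<le> c * norm (x - y)" if "x \<in> cball x0 \<rho>" "y \<in> cball x0 \<rho>" for x y
    by (rule differentiable_bound[OF convex_cball has_derivative_at_withinI[OF der] onorm_le[OF le] that])
  moreover have "c \<ge> 0" by (simp add: c_def sum_nonneg C)
  ultimately show ?thesis using that le by blast
qed

text \<open>The Lipschitz bound applied to the derivatives in basis directions makes the whole
  derivative Lipschitz. The mean value inequality for the linearisation error along the segment then
  yields the second factor \<open>norm (y - x)\<close>.\<close>

lemma smooth_on_cball_taylor:
  fixes h :: "'a::euclidean_space \<Rightarrow> 'b::real_normed_vector"
  assumes "smooth_on V h" "cball x0 \<rho> \<subseteq> V"
  obtains C where "C \<ge> 0" "\<And>x y. x \<in> cball x0 \<rho> \<Longrightarrow> y \<in> cball x0 \<rho> \<Longrightarrow>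
    norm (h y - h x - frechet_derivative h (at x) (y - x)) \<le> C * (norm (y - x))\<^sup>2"
proof -
  let ?D = "\<lambda>x. frechet_derivative h (at x)"
  have "\<exists>C\<ge>0. \<forall>x\<in>cball x0 \<rho>. \<forall>y\<in>cball x0 \<rho>. norm (?D x b - ?D y b) \<le> C * norm (x - y)" for b
    using smooth_on_cball_derivative_bounded[OF smooth_on_frechet_derivative[OF assms(1)] assms(2)] by metis
  then obtain C where C: "\<And>b. C b \<ge> 0" "\<And>b x y. x \<in> cball x0 \<rho> \<Longrightarrow> y \<in> cball x0 \<rho> \<Longrightarrow>
    norm (?D x b - ?D y b) \<le> C b * norm (x - y)"
    by metis
  define c where "c = (\<Sum>b\<in>Basis. C b)"
  have c: "c \<ge> 0" by (simp add: c_def sum_nonneg C)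
  have der: "(h has_derivative ?D x) (at x)" if "x \<in> cball x0 \<rho>" for x
    using assms that by (intro smooth_on_has_derivative[OF assms(1)]) auto
  have le: "norm (?D z u - ?D x u) \<le> c * norm (z - x) * norm u"
    if "x \<in> cball x0 \<rho>" "z \<in> cball x0 \<rho>" for x z u
  proof -
    have "linear (\<lambda>u. ?D z u - ?D x u)"
      using der[OF that(1)] der[OF that(2)] by (intro linear_compose_sub has_derivative_linear)
    then have "norm (?D z u - ?D x u) \<le> (\<Sum>b\<in>Basis. C b * norm (z - x)) * norm u"
      by (rule norm_linear_le_Basis) (intro C that)
    then show ?thesis by (simp add: c_def sum_distrib_right)
  qed
  have "norm (h y - h x - ?D x (y - x)) \<le> c * (norm (y - x))\<^sup>2"
    if x: "x \<in> cball x0 \<rho>" and y: "y \<in> cball x0 \<rho>" for x y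
  proof -
    have sub: "closed_segment x y \<subseteq> cball x0 \<rho>"
      using x y by (simp add: closed_segment_subset)
    have "norm (h y - h x - ?D x (y - x)) \<le> norm (y - x) * (c * norm (y - x))"
    proof (rule differentiable_bound_linearization[where S = "closed_segment x y"])
      show "x + t *\<^sub>R (y - x) \<in> closed_segment x y" if "t \<in> {0..1}" for t
        using that unfolding in_segment(1) by (intro exI[of _ t]) (simp add: algebra_simps)
      show "(h has_derivative ?D z) (at z within closed_segment x y)" if "z \<in> closed_segment x y" for z
        by (rule has_derivative_at_withinI[OF der[OF subsetD[OF sub that]]])
      show "onorm (?D z - ?D x) \<le> c * norm (y - x)" if z: "z \<in> closed_segment x y" for z
      proof (rule onorm_le)
        fix u
        have "norm (?D z u - ?D x u) \<le> c * norm (z - x) * norm u"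
          using sub z x by (intro le) auto
        also have "\<dots> \<le> c * norm (y - x) * norm u"
          using segment_bound(1)[OF z] c by (intro mult_right_mono mult_left_mono) auto
        finally show "norm ((?D z - ?D x) u) \<le> c * norm (y - x) * norm u" by simp
      qed
    qed simp
    then show ?thesis by (simp add: power2_eq_square mult_ac)
  qed
  with c show ?thesis by (rule that)
qed

lemma smooth_on_matrix_vector_mult:
  fixes f :: "'a::euclidean_space \<Rightarrow> real^'n^'m"
  shows "open S \<Longrightarrow> smooth_on S f \<Longrightarrow> smooth_on S g \<Longrightarrow> smooth_on S (\<lambda>x. f x *v g x)"
  by (rule smooth_on_bilinear[OF bounded_bilinear_matrix_vector_mult])

lemma smooth_on_matrix_matrix_mult:
  fixes f :: "'a::euclidean_space \<Rightarrow> real^'n^'m"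
  shows "open S \<Longrightarrow> smooth_on S f \<Longrightarrow> smooth_on S g \<Longrightarrow> smooth_on S (\<lambda>x. f x ** g x)"
  by (rule smooth_on_bilinear[OF bounded_bilinear_matrix_matrix_mult])

lemmas has_derivative_matrix_vector_mult =
  bounded_bilinear.FDERIV[OF bounded_bilinear_matrix_vector_mult]

text \<open>The Leibniz rule moves a derivative from the matrix to the vector. With
  \<open>c = 0\<close> it serves fields in a kernel; with a constant matrix it serves the
  normalisation \<open>L S = id\<close>.\<close>

lemma derivative_of_constant_product:
  fixes B :: "'a::real_normed_vector \<Rightarrow> real^'n^'m"
  assumes "open V" "x \<in> V"
    and "(B has_derivative B') (at x)" "(X has_derivative X') (at x)"
    and "\<And>y. y \<in> V \<Longrightarrow> B y *v X y = c"
  shows "B' u *v X x = - (B x *v X' u)"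
proof -
  have "((\<lambda>y. B y *v X y) has_derivative (\<lambda>u. B x *v X' u + B' u *v X x)) (at x)"
    by (rule has_derivative_matrix_vector_mult[OF assms(3,4)])
  moreover have "((\<lambda>y. B y *v X y) has_derivative (\<lambda>u. 0)) (at x)"
    by (rule has_derivative_transform_within_open[OF has_derivative_const[of c] assms(1,2)])
      (simp add: assms(5))
  ultimately have "(\<lambda>u. B x *v X' u + B' u *v X x) = (\<lambda>u. 0)"
    by (rule has_derivative_unique)
  then show ?thesis by (metis add.commute eq_neg_iff_add_eq_0)
qed

text \<open>Frobenius' involutivity condition for the distribution \<open>ker B\<close>: since \<open>B X = 0\<close> for a field
  \<open>X\<close> of the distribution, \<open>B [X, Y] = DB(Y) X - DB(X) Y\<close>.\<close>

definition kernel_involutive :: "(real^'n) set \<Rightarrow> (real^'n \<Rightarrow> real^'n^'m) \<Rightarrow> bool" where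
  "kernel_involutive D B \<longleftrightarrow> (\<forall>x\<in>D. \<forall>u v. B x *v u = 0 \<longrightarrow> B x *v v = 0 \<longrightarrow>
     frechet_derivative B (at x) u *v v = frechet_derivative B (at x) v *v u)"

lemma integrable_imp_kernel_involutive:
  fixes B :: "real^'n \<Rightarrow> real^'n^'m"
  assumes "open D" "smooth_on D B"
    and "integrable_distribution TYPE('d::finite) D (\<lambda>x. {v. B x *v v = 0})"
  shows "kernel_involutive D B"
  unfolding kernel_involutive_def
proof (intro ballI allI impI)
  fix x u v assume x: "x \<in> D" and u: "B x *v u = 0" and v: "B x *v v = 0"
  obtain W :: "(real^'d) set" and f where W: "open W" "smooth_on W f" "f ` W \<subseteq> D" "x \<in> f ` W"
    and ker: "\<And>w. w \<in> W \<Longrightarrow> range (frechet_derivative f (at w)) = {v. B (f w) *v v = 0}"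
    using assms(3) x unfolding integrable_distribution_def by metis
  let ?D = "\<lambda>w. frechet_derivative f (at w)" and ?B' = "frechet_derivative B (at x)"
  obtain w where w: "w \<in> W" "x = f w" using W(4) by blast
  obtain a b where ab: "u = ?D w a" "v = ?D w b"
    using u v ker[OF w(1)] w(2) by (metis (mono_tags, lifting) imageE mem_Collect_eq)
  have df: "(f has_derivative ?D y) (at y)" if "y \<in> W" for y
    using smooth_on_has_derivative[OF W(2) that] .
  have dBf: "((\<lambda>y. B (f y)) has_derivative (\<lambda>c. ?B' (?D w c))) (at w)"
    using smooth_on_has_derivative[OF assms(2) x] w(2) by (intro has_derivative_compose[OF df[OF w(1)]]) simp
  define E where "E c = frechet_derivative (\<lambda>y. ?D y c) (at w)" for c
  have dE: "((\<lambda>y. ?D y c) has_derivative E c) (at w)" for c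
    unfolding E_def by (rule smooth_on_has_derivative[OF smooth_on_frechet_derivative[OF W(2)] w(1)])
  \<comment> \<open>The partial derivatives of \<open>f\<close> lie in the kernel along the integral
    manifold, so a derivative of \<open>B\<close> becomes \<open>- B\<close> applied to a second
    derivative of \<open>f\<close>.\<close>
  have "?B' (?D w d) *v ?D w c = - (B x *v E c d)" for c d
    using derivative_of_constant_product[OF W(1) w(1) dBf dE, of c 0 d] ker w(2) by auto
  moreover have "E a b = E b a"
    by (rule symmetric_second_derivative[OF W(1) w(1) df dE dE])
  ultimately show "?B' u *v v = ?B' v *v u" by (simp add: ab)
qed

text \<open>The difference \<open>v\<close> of the two sides is the Lie bracket of the fields
  \<open>S a\<close> and \<open>S b\<close>. Involutivity puts it into \<open>ker B\<close>, and
  \<open>L v = 0\<close> because \<open>L S\<close> is constant; but \<open>L\<close> is injective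
  on \<open>ker B\<close>, the range of \<open>S\<close>. The normalised frame therefore
  commutes.\<close>

lemma kernel_frame_symmetric:
  fixes B :: "real^'n \<Rightarrow> real^'n^'m" and S :: "real^'n \<Rightarrow> real^'d^'n" and L :: "real^'n^'d"
  assumes V: "open V" "x \<in> V" "smooth_on V B" "smooth_on V S"
    and inv: "kernel_involutive V B"
    and ker: "\<And>y. y \<in> V \<Longrightarrow> range ((*v) (S y)) = {v. B y *v v = 0}"
    and L: "\<And>y. y \<in> V \<Longrightarrow> L ** S y = mat 1"
  shows "frechet_derivative S (at x) (S x *v a) *v b = frechet_derivative S (at x) (S x *v b) *v a"
proof -
  let ?S' = "frechet_derivative S (at x)" and ?B' = "frechet_derivative B (at x)"
  have dS: "((\<lambda>y. S y *v c) has_derivative (\<lambda>u. ?S' u *v c)) (at x)" for c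
    using has_derivative_matrix_vector_mult[OF smooth_on_has_derivative[OF V(4,2)] has_derivative_const] by simp
  have BS: "B y *v (S y *v c) = 0" if "y \<in> V" for y c
    using ker[OF that] by blast
  have B': "?B' u *v (S x *v c) = - (B x *v (?S' u *v c))" for u c
    by (rule derivative_of_constant_product[OF V(1,2) smooth_on_has_derivative[OF V(3,2)] dS BS])
  have LS: "L *v (S y *v c) = c" if "y \<in> V" for y c
    using L[OF that] by (simp add: matrix_vector_mul_assoc)
  have L': "L *v (?S' u *v c) = 0" for u c
    using derivative_of_constant_product[OF V(1,2) has_derivative_const dS[of c] LS, where u = u] by simp
  define v where "v = ?S' (S x *v a) *v b - ?S' (S x *v b) *v a"
  have "?B' (S x *v a) *v (S x *v b) = ?B' (S x *v b) *v (S x *v a)"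
    using inv V(2) BS unfolding kernel_involutive_def by blast
  then have "B x *v v = 0"
    by (simp add: v_def matrix_vector_mult_diff_distrib B')
  then obtain c where c: "v = S x *v c" using ker[OF V(2)] by blast
  have "L *v v = 0" by (simp add: v_def matrix_vector_mult_diff_distrib L')
  then have "v = 0" using LS[OF V(2)] c by simp
  then show ?thesis by (simp add: v_def)
qed

lemma frame_solution:
  fixes S :: "real^'n \<Rightarrow> real^'d^'n"
  assumes V: "open V" "x0 \<in> V" "smooth_on V S"
    and sym: "\<And>x a b. x \<in> V \<Longrightarrow>
      frechet_derivative S (at x) (S x *v a) *v b = frechet_derivative S (at x) (S x *v b) *v a"
  shows "\<exists>r>0. \<exists>f. f 0 = x0 \<and> (\<forall>w\<in>ball 0 r. f w \<in> V \<and> (f has_derivative (*v) (S (f w))) (at w))"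
proof -
  obtain \<rho> where \<rho>: "\<rho> > 0" "cball x0 \<rho> \<subseteq> V" using V open_contains_cball by blast
  obtain C0 where C0: "C0 \<ge> 0" "\<And>x. x \<in> cball x0 \<rho> \<Longrightarrow> norm (S x) \<le> C0"
    using smooth_on_cball_bounded[OF V(3) \<rho>(2)] by blast
  obtain C1 where C1: "C1 \<ge> 0"
    "\<And>x u. x \<in> cball x0 \<rho> \<Longrightarrow> norm (frechet_derivative S (at x) u) \<le> C1 * norm u"
    "\<And>x y. x \<in> cball x0 \<rho> \<Longrightarrow> y \<in> cball x0 \<rho> \<Longrightarrow> norm (S x - S y) \<le> C1 * norm (x - y)"
    using smooth_on_cball_derivative_bounded[OF V(3) \<rho>(2)] by blast
  obtain C2 where C2: "C2 \<ge> 0" "\<And>x y. x \<in> cball x0 \<rho> \<Longrightarrow> y \<in> cball x0 \<rho> \<Longrightarrow>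
    norm (S y - S x - frechet_derivative S (at x) (y - x)) \<le> C2 * (norm (y - x))\<^sup>2"
    using smooth_on_cball_taylor[OF V(3) \<rho>(2)] by blast
  obtain c where c: "c > 0" "\<And>A a. norm ((A :: real^'d^'n) *v a) \<le> norm A * norm a * c"
    using bounded_bilinear.pos_bounded[OF bounded_bilinear_matrix_vector_mult] by blast
  \<comment> \<open>The sum dominates each of the three bounds from compactness, \<open>c\<close> is
    a constant for the matrix-vector product, and the summand 1 makes \<open>K\<close>
    positive.\<close>
  define K where "K = (C0 + C1 + C2 + 1) * c"
  have K: "K > 0" using C0 C1 C2 c by (simp add: K_def)
  have est: "norm (A *v a) \<le> K * X * norm a"
    if "norm A \<le> C * X" "C \<le> C0 + C1 + C2 + 1" "X \<ge> 0" for A :: "real^'d^'n" and a C X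
  proof -
    have "norm A \<le> (C0 + C1 + C2 + 1) * X"
      using that by (meson mult_right_mono order_trans)
    then have "norm A * norm a * c \<le> ((C0 + C1 + C2 + 1) * X) * norm a * c"
      using c by (intro mult_right_mono) auto
    with c(2)[of A a] show ?thesis by (simp add: K_def mult_ac)
  qed
  have dS: "(S has_derivative frechet_derivative S (at x)) (at x)" if "x \<in> cball x0 \<rho>" for x
    using smooth_on_has_derivative[OF V(3)] that \<rho> by blast
  have "total_differential (\<lambda>x a. S x *v a) (\<lambda>x u a. frechet_derivative S (at x) u *v a) x0 \<rho> K"
  proof (rule total_differential.intro)
    fix x y a b u assume x: "x \<in> cball x0 \<rho>"
    show "linear ((*v) (S x))" by simp
    show "((\<lambda>y. S y *v a) has_derivative (\<lambda>u. frechet_derivative S (at x) u *v a)) (at x)"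
      using has_derivative_matrix_vector_mult[OF dS[OF x] has_derivative_const] by simp
    show "norm (S x *v a) \<le> K * norm a"
      using est[of "S x" C0 1 a] C0(2)[OF x] C1(1) C2(1) by simp
    show "norm (frechet_derivative S (at x) u *v a) \<le> K * norm u * norm a"
      using C0(1) C1(2)[OF x] C2(1) by (intro est) auto
    show "frechet_derivative S (at x) (S x *v a) *v b = frechet_derivative S (at x) (S x *v b) *v a"
      using x \<rho> by (intro sym) auto
    assume y: "y \<in> cball x0 \<rho>"
    show "norm (S x *v a - S y *v a) \<le> K * norm (x - y) * norm a"
      unfolding matrix_vector_mult_diff_rdistrib[symmetric]
      using C0(1) C1(3)[OF x y] C2(1) by (intro est) auto
    show "norm (S y *v a - S x *v a - frechet_derivative S (at x) (y - x) *v a) \<le> K * (norm (y - x))\<^sup>2 * norm a"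
      unfolding matrix_vector_mult_diff_rdistrib[symmetric]
      using C0(1) C1(1) C2(2)[OF x y] by (intro est) auto
  qed (use \<rho> K in auto)
  from total_differential.total_differential_solution[OF this] show ?thesis using \<rho>(2) by blast
qed

lemma kernel_involutive_imp_integrable:
  fixes B :: "real^'n \<Rightarrow> real^'n^'m" and \<Xi> :: "real^'n \<Rightarrow> real^'d^'n"
  assumes D: "open D" "smooth_on D B" "smooth_on D \<Xi>"
    and inv: "kernel_involutive D B"
    and inj: "\<And>x. x \<in> D \<Longrightarrow> inj ((*v) (\<Xi> x))"
    and ker: "\<And>x. x \<in> D \<Longrightarrow> range ((*v) (\<Xi> x)) = {v. B x *v v = 0}"
  shows "integrable_distribution TYPE('d) D (\<lambda>x. {v. B x *v v = 0})"
  unfolding integrable_distribution_def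
proof
  fix x0 assume x0: "x0 \<in> D"
  \<comment> \<open>A left inverse at the single point \<open>x0\<close>: there
    \<open>L \<Xi>\<close> is the identity, so it stays invertible on an open neighbourhood
    \<open>V\<close>.\<close>
  obtain L where L: "L ** \<Xi> x0 = mat 1"
    using inj[OF x0] matrix_left_invertible_injective by blast
  define N where "N x = L ** \<Xi> x" for x
  have N: "smooth_on D N"
    unfolding N_def by (intro smooth_on_matrix_matrix_mult smooth_on_const D)
  define V where "V = {x \<in> D. det (N x) \<noteq> 0}"
  have VD: "V \<subseteq> D" by (auto simp: V_def)
  have V: "open V"
    using continuous_open_preimage[OF smooth_on_imp_continuous_on[OF smooth_on_det[OF D(1) N]] D(1), of "- {0}"]
    by (simp add: V_def vimage_def Int_def open_Compl)
  have x0V: "x0 \<in> V" using x0 L by (simp add: V_def N_def)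
  \<comment> \<open>An invertible change of frame: the range is unchanged, while \<open>L S\<close>
    becomes the identity.\<close>
  define S where "S x = \<Xi> x ** matrix_inv (N x)" for x
  have invN: "invertible (N x)" if "x \<in> V" for x
    using that by (simp add: V_def invertible_det_nz)
  have S: "smooth_on V S"
    unfolding S_def
    by (intro smooth_on_matrix_matrix_mult smooth_on_matrix_inv V invN smooth_on_subset[OF D(3) VD]
        smooth_on_subset[OF N VD])
  have LS: "L ** S x = mat 1" if "x \<in> V" for x
    using matrix_inv_inverse(1)[OF invN[OF that]] by (simp add: S_def N_def matrix_mul_assoc)
  have SN: "S x ** N x = \<Xi> x" if "x \<in> V" for x
    using matrix_inv_inverse(2)[OF invN[OF that]] by (simp add: S_def matrix_mul_assoc[symmetric])
  have kerS: "range ((*v) (S x)) = {v. B x *v v = 0}" if "x \<in> V" for x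
  proof -
    have "\<Xi> x *v c = S x *v (N x *v c)" for c
      by (simp add: matrix_vector_mul_assoc SN[OF that])
    moreover have "S x *v c = \<Xi> x *v (matrix_inv (N x) *v c)" for c
      by (simp add: matrix_vector_mul_assoc S_def)
    ultimately have "range ((*v) (S x)) = range ((*v) (\<Xi> x))" by blast
    then show ?thesis using ker that VD by blast
  qed
  have invV: "kernel_involutive V B"
    using inv VD unfolding kernel_involutive_def by blast
  obtain r f where r: "r > 0" and f0: "f 0 = x0"
    and fV: "\<And>w. w \<in> ball 0 r \<Longrightarrow> f w \<in> V"
    and df: "\<And>w. w \<in> ball 0 r \<Longrightarrow> (f has_derivative (*v) (S (f w))) (at w)"
    using frame_solution[OF V x0V S kernel_frame_symmetric[OF V _ smooth_on_subset[OF D(2) VD] S invV kerS LS]]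
    by blast
  let ?W = "ball (0::real^'d) r"
  have fd: "frechet_derivative f (at w) = (*v) (S (f w))" if "w \<in> ?W" for w
    using frechet_derivative_at[OF df[OF that]] by simp
  have LSv: "L *v (S (f w) *v c) = c" if "w \<in> ?W" for w c
    using LS[OF fV[OF that]] by (simp add: matrix_vector_mul_assoc)
  \<comment> \<open>Bootstrapping: if \<open>f\<close> has order \<open>k\<close>, so does
    \<open>S (f w)\<close>, which is the derivative of \<open>f\<close>; hence \<open>f\<close> has
    order \<open>k + 1\<close>.\<close>
  have "smooth_on ?W f"
    unfolding smooth_on_def
  proof
    fix k show "Ck_on k ?W f"
    proof (induction k)
      case 0
      then show ?case
        unfolding Ck_on.simps by (rule has_derivative_continuous_on[OF has_derivative_at_withinI[OF df]])
    next
      case (Suc k)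
      have Sf: "Ck_on k ?W (\<lambda>w. S (f w))"
        by (rule Ck_on_compose[OF open_ball V _ Suc]) (use S fV in \<open>auto simp: smooth_on_def\<close>)
      show ?case
        by (rule Ck_on_SucI[OF open_ball df], assumption)
          (rule Ck_on_bilinear[OF bounded_bilinear_matrix_vector_mult open_ball Sf Ck_on_const[OF open_ball]])
    qed
  qed
  \<comment> \<open>Since \<open>L S = id\<close>, the map \<open>L f(w) - w\<close> has zero
    derivative. Up to a translation \<open>L\<close> thus recovers the parameter from the
    point.\<close>
  moreover have "inj_on f ?W"
  proof -
    have "((\<lambda>w. L *v f w - w) has_derivative (\<lambda>h. 0)) (at w within ?W)" if "w \<in> ?W" for w
    proof -
      have "((\<lambda>w. L *v f w - w) has_derivative (\<lambda>h. L *v (S (f w) *v h) - h)) (at w)"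
        using has_derivative_matrix_vector_mult[OF has_derivative_const df[OF that], of L]
        by (intro has_derivative_diff has_derivative_ident) simp
      from has_derivative_at_withinI[OF this] show ?thesis
        by (simp add: LSv[OF that])
    qed
    from has_derivative_zero_constant[OF convex_ball this]
    obtain c where c: "\<And>w. w \<in> ?W \<Longrightarrow> L *v f w - w = c" by blast
    show ?thesis
    proof (rule inj_onI)
      fix w w' assume "w \<in> ?W" "w' \<in> ?W" "f w = f w'"
      then show "w = w'" using c[of w] c[of w'] by (simp add: algebra_simps)
    qed
  qed
  moreover have "inj (frechet_derivative f (at w))" if "w \<in> ?W" for w
    unfolding fd[OF that] by (rule inj_on_inverseI[of _ "(*v) L"]) (rule LSv[OF that])
  moreover have "range (frechet_derivative f (at w)) = {v. B (f w) *v v = 0}" if "w \<in> ?W" for w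
    unfolding fd[OF that] by (rule kerS[OF fV[OF that]])
  moreover have "f ` ?W \<subseteq> D" using fV VD by blast
  moreover have "x0 \<in> f ` ?W" using f0 r by (metis centre_in_ball imageI)
  ultimately show "\<exists>(W :: (real^'d) set) f. open W \<and> smooth_on W f \<and> inj_on f W \<and> f ` W \<subseteq> D \<and> x0 \<in> f ` W \<and>
        (\<forall>w\<in>W. inj (frechet_derivative f (at w)) \<and>
                range (frechet_derivative f (at w)) = {v. B (f w) *v v = 0})"
    by (intro exI[of _ ?W] exI[of _ f]) simp
qed

section \<open>Lie brackets and covariant derivatives in coordinates\<close>

lemma pd_nth:
  assumes "(f has_derivative f') (at x)"
  shows "pd (\<lambda>y. f y $ l) \<mu> x = f' (axis \<mu> 1) $ l"
proof -
  have "((\<lambda>y. f y $ l) has_derivative (\<lambda>h. f' h $ l)) (at x)"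
    by (rule bounded_linear.has_derivative[OF bounded_linear_vec_nth assms])
  from frechet_derivative_at[OF this] show ?thesis by (metis pd_def)
qed

lemma linear_axis_sum:
  fixes F :: "real^'n \<Rightarrow> 'b::real_vector"
  assumes "linear F"
  shows "(\<Sum>\<mu>\<in>UNIV. u $ \<mu> *\<^sub>R F (axis \<mu> 1)) = F u"
proof -
  interpret linear F by fact
  have "(\<Sum>\<mu>\<in>UNIV. u $ \<mu> *\<^sub>R F (axis \<mu> 1)) = F (\<Sum>\<mu>\<in>UNIV. u $ \<mu> *s axis \<mu> 1)"
    by (simp add: sum scaleR scalar_mult_eq_scaleR)
  then show ?thesis by (simp only: basis_expansion)
qed

lemma lie_bracket_eq:
  fixes X Y :: "real^'n \<Rightarrow> real^'n"
  assumes X: "(X has_derivative X') (at x)" and Y: "(Y has_derivative Y') (at x)"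
  shows "lie_bracket X Y x = Y' (X x) - X' (Y x)"
proof -
  have "lie_bracket X Y x = (\<Sum>\<mu>\<in>UNIV. X x $ \<mu> *\<^sub>R Y' (axis \<mu> 1)) - (\<Sum>\<mu>\<in>UNIV. Y x $ \<mu> *\<^sub>R X' (axis \<mu> 1))"
    by (simp add: vec_eq_iff lie_bracket_def pd_nth[OF X] pd_nth[OF Y] sum_subtractf)
  then show ?thesis
    by (simp only: linear_axis_sum[OF has_derivative_linear[OF X]] linear_axis_sum[OF has_derivative_linear[OF Y]])
qed

text \<open>Membership in \<open>casimir_forms\<close> includes smoothness, so invariance under the
  bracket of forms requires this besides the kernel condition.\<close>

lemma smooth_on_lie_bracket:
  fixes X Y :: "real^'n \<Rightarrow> real^'n"
  assumes D: "open D" and X: "smooth_on D X" and Y: "smooth_on D Y"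
  shows "smooth_on D (lie_bracket X Y)"
proof (rule smooth_on_cong[OF D])
  let ?L = "\<lambda>X Y x. \<Sum>\<mu>\<in>UNIV. X x $ \<mu> *\<^sub>R frechet_derivative Y (at x) (axis \<mu> 1)"
  show "smooth_on D (\<lambda>x. ?L X Y x - ?L Y X x)"
    by (intro smooth_on_diff smooth_on_sum smooth_on_bilinear[OF bounded_bilinear_scaleR]
        smooth_on_frechet_derivative smooth_on_nth D X Y)
  fix x assume x: "x \<in> D"
  note d = smooth_on_has_derivative[OF X x] smooth_on_has_derivative[OF Y x]
  show "?L X Y x - ?L Y X x = lie_bracket X Y x"
    by (simp only: lie_bracket_eq[OF d] linear_axis_sum[OF has_derivative_linear[OF d(1)]]
        linear_axis_sum[OF has_derivative_linear[OF d(2)]])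
qed

lemma kernel_lie_bracket:
  fixes B :: "real^'n \<Rightarrow> real^'n^'m"
  assumes D: "open D" "x \<in> D" "smooth_on D B" "smooth_on D X" "smooth_on D Y"
    and X: "\<And>y. y \<in> D \<Longrightarrow> B y *v X y = 0" and Y: "\<And>y. y \<in> D \<Longrightarrow> B y *v Y y = 0"
  shows "B x *v lie_bracket X Y x =
    frechet_derivative B (at x) (Y x) *v X x - frechet_derivative B (at x) (X x) *v Y x"
proof -
  note d = smooth_on_has_derivative[OF D(4,2)] smooth_on_has_derivative[OF D(5,2)]
    smooth_on_has_derivative[OF D(3,2)]
  show ?thesis
    by (simp add: lie_bracket_eq[OF d(1,2)] matrix_vector_mult_diff_distrib
        derivative_of_constant_product[OF D(1,2) d(3,1) X] derivative_of_constant_product[OF D(1,2) d(3,2) Y])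
qed

text \<open>Both sides of the pointwise condition are bilinear in \<open>u\<close> and
  \<open>v\<close>, so spanning vectors are enough; on the values of the frame fields it says that
  \<open>B\<close> kills their bracket.\<close>

lemma kernel_involutive_iff_frame:
  fixes B :: "real^'n \<Rightarrow> real^'n^'m"
  assumes D: "open D" "smooth_on D B" and X: "\<And>i. smooth_on D (X i)"
    and ker: "\<And>x i. x \<in> D \<Longrightarrow> B x *v X i x = 0"
    and span: "\<And>x. x \<in> D \<Longrightarrow> {v. B x *v v = 0} \<subseteq> span (range (\<lambda>i. X i x))"
  shows "kernel_involutive D B \<longleftrightarrow> (\<forall>x\<in>D. \<forall>i j. B x *v lie_bracket (X i) (X j) x = 0)"
proof -
  have "(\<forall>u v. B x *v u = 0 \<longrightarrow> B x *v v = 0 \<longrightarrow>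
      frechet_derivative B (at x) u *v v = frechet_derivative B (at x) v *v u) \<longleftrightarrow>
    (\<forall>i j. frechet_derivative B (at x) (X j x) *v X i x = frechet_derivative B (at x) (X i x) *v X j x)"
    (is "?L \<longleftrightarrow> ?R") if x: "x \<in> D" for x
  proof
    assume ?L then show ?R using ker[OF x] by blast
  next
    assume R: ?R
    let ?B' = "frechet_derivative B (at x)"
    have lin: "linear ?B'"
      using has_derivative_linear[OF smooth_on_has_derivative[OF D(2) x]] .
    have bil: "bilinear (\<lambda>u v. ?B' u *v v)" "bilinear (\<lambda>u v. ?B' v *v u)"
      using lin unfolding bilinear_def
      by (auto intro!: linearI simp: linear_add linear_scale matrix_vector_mult_add_rdistrib
          matrix_vector_right_distrib scaleR_matrix_vector_assoc matrix_vector_mult_scaleR)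
    show ?L
    proof (intro allI impI)
      fix u v assume "B x *v u = 0" "B x *v v = 0"
      then show "?B' u *v v = ?B' v *v u"
        using bilinear_eq[OF bil span[OF x] span[OF x], of u v] R by auto
    qed
  qed
  then show ?thesis
    unfolding kernel_involutive_def
    using kernel_lie_bracket[OF D(1) _ D(2) X X ker ker] by simp
qed

section \<open>The orthogonal complement as a kernel, and frames as matrices\<close>

lemma integrable_distribution_cong:
  fixes T :: "'d::finite itself"
  assumes "\<And>x. x \<in> D \<Longrightarrow> E x = E' x"
  shows "integrable_distribution T D E \<longleftrightarrow> integrable_distribution T D E'"
  unfolding integrable_distribution_def
proof (intro ball_cong refl ex_cong1)
  fix W :: "(real^'d) set" and f
  have "E (f w) = E' (f w)" if "f ` W \<subseteq> D" "w \<in> W" for w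
    using that by (intro assms) auto
  then show "(open W \<and> smooth_on W f \<and> inj_on f W \<and> f ` W \<subseteq> D \<and> x \<in> f ` W \<and>
        (\<forall>w\<in>W. inj (frechet_derivative f (at w)) \<and> range (frechet_derivative f (at w)) = E (f w))) \<longleftrightarrow>
      (open W \<and> smooth_on W f \<and> inj_on f W \<and> f ` W \<subseteq> D \<and> x \<in> f ` W \<and>
        (\<forall>w\<in>W. inj (frechet_derivative f (at w)) \<and> range (frechet_derivative f (at w)) = E' (f w)))" for x
    by (intro conj_cong ball_cong refl) simp
qed

text \<open>Skewness of \<open>p\<close> and symmetry of \<open>q\<close> make
  \<open>- (p ** q)\<close> the transpose of \<open>q ** p\<close>. Orthogonality to every
  \<open>p *v \<alpha>\<close> thus says that \<open>(p ** q) *v v\<close> is orthogonal to every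
  covector.\<close>

lemma leaf_orthogonal_eq_kernel:
  fixes p q :: "real^'n^'n"
  assumes "transpose p = - p" "transpose q = q"
  shows "leaf_orthogonal p q = {v. (p ** q) *v v = 0}"
proof -
  have "v \<bullet> (q *v (p *v \<alpha>)) = - (((p ** q) *v v) \<bullet> \<alpha>)" for v \<alpha>
  proof -
    have "v \<bullet> (q *v (p *v \<alpha>)) = (v v* (q ** p)) \<bullet> \<alpha>"
      by (simp add: dot_lmul_matrix matrix_vector_mul_assoc)
    also have "v v* (q ** p) = transpose (q ** p) *v v"
      by simp
    also have "transpose (q ** p) = - (p ** q)"
      unfolding matrix_transpose_mul assms by (simp add: vec_eq_iff matrix_matrix_mult_def sum_negf)
    also have "- (p ** q) *v v = - ((p ** q) *v v)"
      by (simp add: vec_eq_iff matrix_vector_mult_def sum_negf)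
    finally show ?thesis by simp
  qed
  then show ?thesis
    by (auto simp: leaf_orthogonal_def leaf_tangent_def)
qed

lemma column_matrix:
  fixes u :: "'d::finite \<Rightarrow> real^'n"
  shows "(\<chi> a i. u i $ a) *v c = (\<Sum>i\<in>UNIV. c $ i *\<^sub>R u i)"
  by (simp add: vec_eq_iff matrix_vector_mult_def mult.commute)

text \<open>Independence is a property of the set of values; injectivity of the indexing turns it
  into independence of the family, hence of the columns.\<close>

lemma column_matrix_basis:
  fixes u :: "'d::finite \<Rightarrow> real^'n"
  assumes "inj u" "independent (range u)"
  shows "inj ((*v) (\<chi> a i. u i $ a))" "range ((*v) (\<chi> a i. u i $ a)) = span (range u)"
proof -
  let ?M = "\<chi> a i. u i $ a"
  have "c = 0" if "?M *v c = 0" for c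
  proof -
    have "(\<Sum>v\<in>range u. c $ inv u v *\<^sub>R v) = (\<Sum>i\<in>UNIV. c $ i *\<^sub>R u i)"
      by (simp add: sum.reindex[OF assms(1)] inv_f_f[OF assms(1)])
    also have "\<dots> = 0" using that by (simp add: column_matrix)
    finally have "c $ inv u (u i) = 0" for i
      using independentD[OF assms(2), of "range u" "\<lambda>v. c $ inv u v" "u i"] by auto
    then show ?thesis by (simp add: vec_eq_iff inv_f_f[OF assms(1)])
  qed
  then show "inj ((*v) ?M)" by (simp add: linear_injective_0[OF matrix_vector_mul_linear])
  have "u i = ?M *v axis i 1" for i
    unfolding matrix_vector_mult_basis by (simp add: column_def vec_eq_iff)
  then have "range u \<subseteq> range ((*v) ?M)" by blast
  then have "span (range u) \<subseteq> range ((*v) ?M)"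
    by (intro span_minimal linear_subspace_image subspace_UNIV matrix_vector_mul_linear)
  moreover have "?M *v c \<in> span (range u)" for c
    unfolding column_matrix by (intro span_sum span_scale span_base) auto
  ultimately show "range ((*v) ?M) = span (range u)" by blast
qed

section \<open>Covariant derivatives: torsion, lowering of indices, Casimir forms\<close>

lemma cov_vector_torsion_free:
  fixes q :: "real^'n \<Rightarrow> real^'n^'n"
  assumes "open D" "x \<in> D" "\<And>y. y \<in> D \<Longrightarrow> transpose (q y) = q y"
  shows "cov_vector q X Y x - cov_vector q Y X x = lie_bracket X Y x"
proof -
  have "(\<Sum>\<mu>\<in>UNIV. \<Sum>\<nu>\<in>UNIV. Y x $ \<mu> * (christoffel q x l \<mu> \<nu> * X x $ \<nu>))
      = (\<Sum>\<mu>\<in>UNIV. \<Sum>\<nu>\<in>UNIV. X x $ \<mu> * (christoffel q x l \<mu> \<nu> * Y x $ \<nu>))" for l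
    by (subst sum.swap) (simp add: christoffel_torsion_free[where q = q and D = D, OF assms, of l] mult_ac)
  then show ?thesis
    by (simp add: vec_eq_iff cov_vector_def lie_bracket_def sum_subtractf sum.distrib
        distrib_left sum_distrib_left)
qed

lemma pd_cong:
  assumes "open D" "x \<in> D" "\<And>y. y \<in> D \<Longrightarrow> f y = h y"
  shows "pd f l x = pd h l x"
proof -
  have "(f has_derivative F) (at x) \<longleftrightarrow> (h has_derivative F) (at x)" for F
    using has_derivative_transform_within_open[OF _ assms(1,2)] assms(3) by metis
  then show ?thesis unfolding pd_def frechet_derivative_def by simp
qed

lemma pd_sum_mult:
  assumes "\<And>i. (f i has_derivative f' i) (at x)" "\<And>i. (h i has_derivative h' i) (at x)"
  shows "pd (\<lambda>y. \<Sum>i\<in>UNIV. f i y * h i y) l x = (\<Sum>i\<in>UNIV. pd (f i) l x * h i x + f i x * pd (h i) l x)"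
proof -
  have "((\<lambda>y. \<Sum>i\<in>UNIV. f i y * h i y) has_derivative (\<lambda>v. \<Sum>i\<in>UNIV. f i x * h' i v + f' i v * h i x)) (at x)"
    by (intro has_derivative_sum has_derivative_mult assms)
  moreover have "frechet_derivative (f i) (at x) = f' i" "frechet_derivative (h i) (at x) = h' i" for i
    using frechet_derivative_at[OF assms(1)] frechet_derivative_at[OF assms(2)] by metis+
  ultimately show ?thesis
    unfolding pd_def using frechet_derivative_at[of "\<lambda>y. \<Sum>i\<in>UNIV. f i y * h i y"]
    by (metis (no_types, lifting) add.commute sum.cong)
qed

lemma pd_matrix_vector_mult:
  fixes q :: "real^'n \<Rightarrow> real^'m^'k"
  assumes "smooth_on D q" "smooth_on D Y" "open D" "x \<in> D"
  shows "pd (\<lambda>y. (q y *v Y y) $ \<sigma>) l x =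
    (\<Sum>\<nu>\<in>UNIV. pd (\<lambda>y. q y $ \<sigma> $ \<nu>) l x * Y x $ \<nu> + q x $ \<sigma> $ \<nu> * pd (\<lambda>y. Y y $ \<nu>) l x)"
  unfolding matrix_vector_mult_def vec_lambda_beta
  by (rule pd_sum_mult) (rule smooth_on_has_derivative[OF smooth_on_nth[OF assms(3) smooth_on_nth[OF assms(3,1)]] assms(4)]
      smooth_on_has_derivative[OF smooth_on_nth[OF assms(3,2)] assms(4)])+

text \<open>Metric compatibility expands the partial derivative of \<open>q\<close> into two
  Christoffel sums. One cancels the connection term of the form, the other becomes the connection
  term of the vector field.\<close>

lemma cov_form_lower:
  fixes q :: "real^'n \<Rightarrow> real^'n^'n"
  assumes D: "open D" "x \<in> D" and q: "smooth_on D q" and Y: "smooth_on D Y"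
    and sym: "\<And>y. y \<in> D \<Longrightarrow> transpose (q y) = q y" and inv: "invertible (q x)"
    and \<alpha>: "\<And>y. y \<in> D \<Longrightarrow> \<alpha> y = q y *v Y y"
  shows "cov_form q X \<alpha> x = q x *v cov_vector q X Y x"
proof -
  let ?\<Gamma> = "christoffel q x"
  have *: "pd (\<lambda>y. \<alpha> y $ \<sigma>) \<mu> x - (\<Sum>\<nu>\<in>UNIV. ?\<Gamma> \<nu> \<mu> \<sigma> * \<alpha> x $ \<nu>) =
    (\<Sum>l\<in>UNIV. q x $ \<sigma> $ l * (pd (\<lambda>y. Y y $ l) \<mu> x + (\<Sum>\<nu>\<in>UNIV. ?\<Gamma> l \<mu> \<nu> * Y x $ \<nu>)))" for \<sigma> \<mu>
  proof -
    have "pd (\<lambda>y. \<alpha> y $ \<sigma>) \<mu> x = pd (\<lambda>y. (q y *v Y y) $ \<sigma>) \<mu> x"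
      by (rule pd_cong[OF D]) (simp add: \<alpha>)
    also have "\<dots> = (\<Sum>\<nu>\<in>UNIV. pd (\<lambda>y. q y $ \<sigma> $ \<nu>) \<mu> x * Y x $ \<nu>) + (\<Sum>\<nu>\<in>UNIV. q x $ \<sigma> $ \<nu> * pd (\<lambda>y. Y y $ \<nu>) \<mu> x)"
      by (simp add: pd_matrix_vector_mult[OF q Y D] sum.distrib)
    also have "(\<Sum>\<nu>\<in>UNIV. pd (\<lambda>y. q y $ \<sigma> $ \<nu>) \<mu> x * Y x $ \<nu>)
        = (\<Sum>\<nu>\<in>UNIV. \<Sum>\<kappa>\<in>UNIV. ?\<Gamma> \<kappa> \<mu> \<sigma> * q x $ \<kappa> $ \<nu> * Y x $ \<nu>)
        + (\<Sum>\<nu>\<in>UNIV. \<Sum>\<kappa>\<in>UNIV. ?\<Gamma> \<kappa> \<mu> \<nu> * q x $ \<sigma> $ \<kappa> * Y x $ \<nu>)"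
      by (simp add: christoffel_metric[where q = q, OF D sym inv] distrib_right sum.distrib sum_distrib_right)
    also have "(\<Sum>\<nu>\<in>UNIV. \<Sum>\<kappa>\<in>UNIV. ?\<Gamma> \<kappa> \<mu> \<sigma> * q x $ \<kappa> $ \<nu> * Y x $ \<nu>) = (\<Sum>\<nu>\<in>UNIV. ?\<Gamma> \<nu> \<mu> \<sigma> * \<alpha> x $ \<nu>)"
      by (subst sum.swap) (simp add: \<alpha>[OF D(2)] matrix_vector_mult_def sum_distrib_left mult_ac)
    also have "(\<Sum>\<nu>\<in>UNIV. \<Sum>\<kappa>\<in>UNIV. ?\<Gamma> \<kappa> \<mu> \<nu> * q x $ \<sigma> $ \<kappa> * Y x $ \<nu>)
        = (\<Sum>l\<in>UNIV. q x $ \<sigma> $ l * (\<Sum>\<nu>\<in>UNIV. ?\<Gamma> l \<mu> \<nu> * Y x $ \<nu>))"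
      by (subst sum.swap) (simp add: sum_distrib_left mult_ac)
    finally show ?thesis by (simp add: distrib_left sum.distrib)
  qed
  have "cov_form q X \<alpha> x $ \<sigma> = (q x *v cov_vector q X Y x) $ \<sigma>" for \<sigma>
  proof -
    have "cov_form q X \<alpha> x $ \<sigma> = (\<Sum>\<mu>\<in>UNIV. \<Sum>l\<in>UNIV. X x $ \<mu> * (q x $ \<sigma> $ l *
        (pd (\<lambda>y. Y y $ l) \<mu> x + (\<Sum>\<nu>\<in>UNIV. ?\<Gamma> l \<mu> \<nu> * Y x $ \<nu>))))"
      by (simp add: cov_form_def * sum_distrib_left)
    also have "\<dots> = (q x *v cov_vector q X Y x) $ \<sigma>"
      by (subst sum.swap) (simp add: cov_vector_def matrix_vector_mult_def sum_distrib_left mult_ac)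
    finally show ?thesis .
  qed
  then show ?thesis by (simp add: vec_eq_iff)
qed

text \<open>This is the Leibniz rule for \<open>P \<alpha> = 0\<close>. The Christoffel sum for the
  free index \<tau> contains the factor \<open>P \<alpha>\<close> and vanishes; the one for the
  contracted index becomes the connection term of \<open>\<alpha>\<close>.\<close>

lemma cov_bivector_casimir:
  fixes p q :: "real^'n \<Rightarrow> real^'n^'n"
  assumes D: "open D" "x \<in> D" and p: "smooth_on D p" and \<alpha>: "smooth_on D \<alpha>"
    and cas: "\<And>y. y \<in> D \<Longrightarrow> p y *v \<alpha> y = 0"
  shows "(\<Sum>l\<in>UNIV. X x $ l * (\<Sum>\<sigma>\<in>UNIV. cov_bivector q l p x $ \<tau> $ \<sigma> * \<alpha> x $ \<sigma>)) =
    - (p x *v cov_form q X \<alpha> x) $ \<tau>"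
proof -
  let ?\<Gamma> = "christoffel q x"
  have *: "(\<Sum>\<sigma>\<in>UNIV. cov_bivector q l p x $ \<tau> $ \<sigma> * \<alpha> x $ \<sigma>) =
    - (\<Sum>\<sigma>\<in>UNIV. p x $ \<tau> $ \<sigma> * (pd (\<lambda>y. \<alpha> y $ \<sigma>) l x - (\<Sum>\<nu>\<in>UNIV. ?\<Gamma> \<nu> l \<sigma> * \<alpha> x $ \<nu>)))" for l
  proof -
    have "pd (\<lambda>y. (p y *v \<alpha> y) $ \<tau>) l x = pd (\<lambda>y. 0) l x"
      by (rule pd_cong[OF D]) (simp add: cas)
    then have leibniz: "(\<Sum>\<sigma>\<in>UNIV. pd (\<lambda>y. p y $ \<tau> $ \<sigma>) l x * \<alpha> x $ \<sigma>) = - (\<Sum>\<sigma>\<in>UNIV. p x $ \<tau> $ \<sigma> * pd (\<lambda>y. \<alpha> y $ \<sigma>) l x)"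
      by (simp add: pd_matrix_vector_mult[OF p \<alpha> D] sum.distrib eq_neg_iff_add_eq_0) (simp add: pd_def)
    have cas_x: "(\<Sum>\<sigma>\<in>UNIV. p x $ \<mu> $ \<sigma> * \<alpha> x $ \<sigma>) = 0" for \<mu>
      using cas[OF D(2)] by (simp add: vec_eq_iff matrix_vector_mult_def)
    have "(\<Sum>\<sigma>\<in>UNIV. (\<Sum>\<mu>\<in>UNIV. ?\<Gamma> \<tau> l \<mu> * p x $ \<mu> $ \<sigma>) * \<alpha> x $ \<sigma>)
        = (\<Sum>\<mu>\<in>UNIV. ?\<Gamma> \<tau> l \<mu> * (\<Sum>\<sigma>\<in>UNIV. p x $ \<mu> $ \<sigma> * \<alpha> x $ \<sigma>))"
      unfolding sum_distrib_right sum_distrib_left by (subst sum.swap) (simp add: mult_ac)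
    moreover have "(\<Sum>\<sigma>\<in>UNIV. (\<Sum>\<mu>\<in>UNIV. ?\<Gamma> \<sigma> l \<mu> * p x $ \<tau> $ \<mu>) * \<alpha> x $ \<sigma>)
        = (\<Sum>\<sigma>\<in>UNIV. p x $ \<tau> $ \<sigma> * (\<Sum>\<nu>\<in>UNIV. ?\<Gamma> \<nu> l \<sigma> * \<alpha> x $ \<nu>))"
      unfolding sum_distrib_right sum_distrib_left by (subst sum.swap) (simp add: mult_ac)
    ultimately show ?thesis
      by (simp add: cov_bivector_def distrib_right right_diff_distrib sum.distrib sum_subtractf leibniz cas_x)
  qed
  have "(\<Sum>l\<in>UNIV. X x $ l * (\<Sum>\<sigma>\<in>UNIV. p x $ \<tau> $ \<sigma> * h l \<sigma>)) = (\<Sum>\<sigma>\<in>UNIV. p x $ \<tau> $ \<sigma> * (\<Sum>l\<in>UNIV. X x $ l * h l \<sigma>))" for h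
    unfolding sum_distrib_left by (subst sum.swap) (simp add: mult_ac)
  then show ?thesis
    by (simp add: * sum_negf cov_form_def matrix_vector_mult_def)
qed

text \<open>In each half of the wedge the inverse metric raises one form to the direction of
  differentiation, and the other is contracted with the derivative of \<open>P\<close>. The sign
  from moving the derivative to the form reverses the order of the two terms.\<close>

lemma cov_bivector_wedge:
  fixes p q :: "real^'n \<Rightarrow> real^'n^'n"
  assumes D: "open D" "x \<in> D" and p: "smooth_on D p" and \<alpha>: "smooth_on D \<alpha>" and \<beta>: "smooth_on D \<beta>"
    and cas: "\<And>y. y \<in> D \<Longrightarrow> p y *v \<alpha> y = 0" "\<And>y. y \<in> D \<Longrightarrow> p y *v \<beta> y = 0"
  shows "(\<Sum>l\<in>UNIV. \<Sum>\<rho>\<in>UNIV. \<Sum>\<sigma>\<in>UNIV. matrix_inv (q x) $ l $ \<rho> *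
      cov_bivector q l p x $ \<tau> $ \<sigma> * wedge (\<alpha> x) (\<beta> x) \<sigma> \<rho>) =
    (p x *v (cov_form q (sharp q \<alpha>) \<beta> x - cov_form q (sharp q \<beta>) \<alpha> x)) $ \<tau>"
proof -
  have *: "(\<Sum>l\<in>UNIV. \<Sum>\<rho>\<in>UNIV. \<Sum>\<sigma>\<in>UNIV. matrix_inv (q x) $ l $ \<rho> * (T l \<sigma> * (a $ \<sigma> * \<gamma> x $ \<rho>)))
      = (\<Sum>l\<in>UNIV. sharp q \<gamma> x $ l * (\<Sum>\<sigma>\<in>UNIV. T l \<sigma> * a $ \<sigma>))" for T a \<gamma>
    by (simp add: sharp_def matrix_vector_mult_def sum_distrib_left sum_distrib_right mult_ac)
  have "(\<Sum>l\<in>UNIV. \<Sum>\<rho>\<in>UNIV. \<Sum>\<sigma>\<in>UNIV. matrix_inv (q x) $ l $ \<rho> *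
      cov_bivector q l p x $ \<tau> $ \<sigma> * wedge (\<alpha> x) (\<beta> x) \<sigma> \<rho>)
    = (\<Sum>l\<in>UNIV. \<Sum>\<rho>\<in>UNIV. \<Sum>\<sigma>\<in>UNIV. matrix_inv (q x) $ l $ \<rho> * (cov_bivector q l p x $ \<tau> $ \<sigma> * (\<alpha> x $ \<sigma> * \<beta> x $ \<rho>)))
    - (\<Sum>l\<in>UNIV. \<Sum>\<rho>\<in>UNIV. \<Sum>\<sigma>\<in>UNIV. matrix_inv (q x) $ l $ \<rho> * (cov_bivector q l p x $ \<tau> $ \<sigma> * (\<beta> x $ \<sigma> * \<alpha> x $ \<rho>)))"
    by (simp add: wedge_def right_diff_distrib sum_subtractf mult_ac)
  also have "\<dots> = - (p x *v cov_form q (sharp q \<beta>) \<alpha> x) $ \<tau> + (p x *v cov_form q (sharp q \<alpha>) \<beta> x) $ \<tau>"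
    unfolding *[of "\<lambda>l \<sigma>. cov_bivector q l p x $ \<tau> $ \<sigma>" "\<alpha> x" \<beta>]
      *[of "\<lambda>l \<sigma>. cov_bivector q l p x $ \<tau> $ \<sigma>" "\<beta> x" \<alpha>]
    by (simp add: cov_bivector_casimir[OF D p \<alpha> cas(1)] cov_bivector_casimir[OF D p \<beta> cas(2)])
  finally show ?thesis by (simp add: matrix_vector_mult_diff_distrib)
qed

section \<open>The equivalences in a chart\<close>

theorem theorem1:
  fixes A :: "('m::{t2_space,second_countable_topology}, 'n::finite) chart set"
    and P g :: "('m, 'n) tensor2"
    and k :: nat
    and c :: "('m, 'n) chart"
    and \<omega> \<xi> :: "'d::finite \<Rightarrow> real^'n \<Rightarrow> real^'n"
  assumes manifold: "smooth_atlas A"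
    and poisson: "regular_poisson A P k"
    and metric: "pseudo_riemannian A g"
    and leaves: "nondegenerate_on_leaves A P g"
    and chart: "c \<in> A"
    and corank: "CARD('d) = CARD('n) - k"
    and basis: "casimir_basis (crange c) (P c) \<omega>"
    and xi: "\<And>i. \<xi> i = sharp (g c) (\<omega> i)"
  defines "integrable_N \<equiv>
      integrable_distribution TYPE('d) (crange c) (\<lambda>x. leaf_orthogonal (P c x) (g c x))"
    and "cond_forms \<equiv> \<forall>x\<in>crange c. \<forall>i j. \<forall>\<tau>.
      (\<Sum>\<sigma>\<in>UNIV. P c x $ \<tau> $ \<sigma> *
         (cov_form (g c) (\<xi> i) (\<omega> j) x $ \<sigma> - cov_form (g c) (\<xi> j) (\<omega> i) x $ \<sigma>)) = 0"
    and "cond_bivector \<equiv> \<forall>x\<in>crange c. \<forall>i j. \<forall>\<tau>.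
      (\<Sum>l\<in>UNIV. \<Sum>\<alpha>\<in>UNIV. \<Sum>\<sigma>\<in>UNIV. matrix_inv (g c x) $ l $ \<alpha> *
         cov_bivector (g c) l (P c) x $ \<tau> $ \<sigma> * wedge (\<omega> i x) (\<omega> j x) \<sigma> \<alpha>) = 0"
    and "cond_vectors \<equiv> \<forall>x\<in>crange c. \<forall>i j. \<forall>\<tau>.
      (\<Sum>\<sigma>\<in>UNIV. \<Sum>l\<in>UNIV. P c x $ \<tau> $ \<sigma> * g c x $ \<sigma> $ l *
         (cov_vector (g c) (\<xi> i) (\<xi> j) x $ l - cov_vector (g c) (\<xi> j) (\<xi> i) x $ l)) = 0"
    and "bracket_invariant \<equiv> \<forall>\<alpha>\<in>casimir_forms (crange c) (P c). \<forall>\<beta>\<in>casimir_forms (crange c) (P c).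
      form_bracket (g c) \<alpha> \<beta> \<in> casimir_forms (crange c) (P c)"
  shows "(integrable_N \<longleftrightarrow> cond_forms) \<and> (integrable_N \<longleftrightarrow> cond_bivector) \<and>
    (integrable_N \<longleftrightarrow> cond_vectors) \<and> (integrable_N \<longleftrightarrow> bracket_invariant)"
proof -
  define D p q where "D = crange c" and "p = P c" and "q = g c"
  define B where "B x = p x ** q x" for x
  have D: "open D"
    using manifold chart by (auto simp: smooth_atlas_def D_def)
  have biv: "poisson_bivector A P"
    using poisson by (simp add: regular_poisson_def)
  have p: "smooth_on D p"
    using biv chart by (simp add: poisson_bivector_def contravariant2_def D_def p_def)
  have p_skew: "transpose (p x) = - p x" if "x \<in> D" for x
    using biv chart that by (simp add: poisson_bivector_def D_def p_def)
  have q: "smooth_on D q"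
    using metric chart by (simp add: pseudo_riemannian_def covariant2_def D_def q_def)
  have q_sym: "transpose (q x) = q x" and q_inv: "invertible (q x)" if "x \<in> D" for x
    using metric chart that by (auto simp: pseudo_riemannian_def D_def q_def)
  have qq: "q x *v (matrix_inv (q x) *v v) = v" "matrix_inv (q x) *v (q x *v v) = v" if "x \<in> D" for x v
    using matrix_inv_inverse[OF q_inv[OF that]] by (simp_all add: matrix_vector_mul_assoc)
  have \<omega>: "smooth_on D (\<omega> i)" for i
    using basis by (simp add: casimir_basis_def D_def)
  have \<omega>_basis: "inj (\<lambda>i. \<omega> i x)" "independent (range (\<lambda>i. \<omega> i x))"
    "span (range (\<lambda>i. \<omega> i x)) = casimir (p x)" if "x \<in> D" for x
    using basis that by (auto simp: casimir_basis_def D_def p_def)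
  have \<omega>_cas: "p x *v \<omega> i x = 0" if "x \<in> D" for x i
    using \<omega>_basis(3)[OF that] span_base[of "\<omega> i x" "range (\<lambda>i. \<omega> i x)"] by (auto simp: casimir_def)
  have B: "smooth_on D B"
    unfolding B_def by (intro smooth_on_matrix_matrix_mult D p q)
  have sharp_smooth: "smooth_on D (sharp q \<alpha>)" if "smooth_on D \<alpha>" for \<alpha>
    unfolding sharp_def by (intro smooth_on_matrix_vector_mult smooth_on_matrix_inv D q q_inv that)
  have B_sharp: "B x *v sharp q \<alpha> x = p x *v \<alpha> x" if "x \<in> D" for x \<alpha>
    by (simp add: B_def sharp_def matrix_vector_mul_assoc[symmetric] qq[OF that])
  have xi': "\<xi> i = sharp q (\<omega> i)" for i
    by (simp add: xi q_def)
  have \<xi>: "smooth_on D (\<xi> i)" for i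
    unfolding xi' by (rule sharp_smooth[OF \<omega>])
  have B_\<xi>: "B x *v \<xi> i x = 0" if "x \<in> D" for x i
    unfolding xi' by (simp add: B_sharp \<omega>_cas that)
  have flat_\<xi>: "\<omega> i x = q x *v \<xi> i x" if "x \<in> D" for x i
    by (simp add: xi' sharp_def qq[OF that])

  \<comment> \<open>The matrix with columns \<open>\<xi> i x\<close> is the frame of
    \<open>ker B\<close> to which Frobenius' theorem is applied. Being the inverse metric times the
    matrix of the Casimir basis, it inherits injectivity from that basis.\<close>
  define \<Xi> where "\<Xi> x = (\<chi> a i. \<xi> i x $ a)" for x
  have \<Xi>: "smooth_on D \<Xi>"
    by (intro smooth_on_vec D) (simp add: \<Xi>_def smooth_on_nth[OF D \<xi>])
  have \<Xi>_eq: "\<Xi> x *v a = matrix_inv (q x) *v ((\<chi> a i. \<omega> i x $ a) *v a)" for x a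
    unfolding \<Xi>_def column_matrix
    by (simp add: xi' sharp_def linear_sum[OF matrix_vector_mul_linear] matrix_vector_mult_scaleR)
  have \<Xi>_inj: "inj ((*v) (\<Xi> x))" if "x \<in> D" for x
  proof (rule injI)
    fix a b assume "\<Xi> x *v a = \<Xi> x *v b"
    then have "(\<chi> a i. \<omega> i x $ a) *v a = (\<chi> a i. \<omega> i x $ a) *v b"
      unfolding \<Xi>_eq by (metis qq(1)[OF that])
    then show "a = b"
      using column_matrix_basis(1)[OF \<omega>_basis(1,2)[OF that]] by (simp add: inj_eq)
  qed
  have \<Xi>_ker: "range ((*v) (\<Xi> x)) = {v. B x *v v = 0}" if x: "x \<in> D" for x
  proof (intro equalityI subsetI)
    fix v assume "v \<in> range ((*v) (\<Xi> x))"
    then obtain a where a: "v = (\<Sum>i\<in>UNIV. a $ i *\<^sub>R \<xi> i x)" by (auto simp: \<Xi>_def column_matrix)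
    show "v \<in> {v. B x *v v = 0}"
      by (simp add: a linear_sum[OF matrix_vector_mul_linear] matrix_vector_mult_scaleR B_\<xi>[OF x])
  next
    fix v assume "v \<in> {v. B x *v v = 0}"
    then have "q x *v v \<in> casimir (p x)"
      by (simp add: casimir_def B_def matrix_vector_mul_assoc)
    then obtain a where a: "q x *v v = (\<chi> a i. \<omega> i x $ a) *v a"
      using column_matrix_basis(2)[OF \<omega>_basis(1,2)[OF x]] \<omega>_basis(3)[OF x] by auto
    have "v = matrix_inv (q x) *v (q x *v v)" by (simp only: qq(2)[OF x])
    also have "\<dots> = \<Xi> x *v a" by (simp only: a \<Xi>_eq)
    finally show "v \<in> range ((*v) (\<Xi> x))" by blast
  qed
  have \<xi>_span: "{v. B x *v v = 0} \<subseteq> span (range (\<lambda>i. \<xi> i x))" if "x \<in> D" for x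
  proof -
    have "\<Xi> x *v a \<in> span (range (\<lambda>i. \<xi> i x))" for a
      unfolding \<Xi>_def column_matrix by (intro span_sum span_scale span_base) auto
    then show ?thesis by (auto simp flip: \<Xi>_ker[OF that])
  qed

  have integrable: "integrable_N \<longleftrightarrow> kernel_involutive D B"
  proof -
    have "leaf_orthogonal (p x) (q x) = {v. B x *v v = 0}" if "x \<in> D" for x
      unfolding B_def by (rule leaf_orthogonal_eq_kernel[OF p_skew[OF that] q_sym[OF that]])
    then have "integrable_N \<longleftrightarrow> integrable_distribution TYPE('d) D (\<lambda>x. {v. B x *v v = 0})"
      unfolding integrable_N_def D_def[symmetric] p_def[symmetric] q_def[symmetric]
      by (rule integrable_distribution_cong)
    then show ?thesis
      using integrable_imp_kernel_involutive[OF D B]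
        kernel_involutive_imp_integrable[OF D B \<Xi> _ \<Xi>_inj \<Xi>_ker] by blast
  qed

  have frame: "kernel_involutive D B \<longleftrightarrow> (\<forall>x\<in>D. \<forall>i j. B x *v lie_bracket (\<xi> i) (\<xi> j) x = 0)"
    by (rule kernel_involutive_iff_frame[OF D B \<xi> B_\<xi> \<xi>_span])

  \<comment> \<open>The bracket is the common form of the covariant conditions: torsion freeness
    produces it from vector fields, and metric compatibility reduces forms to vector fields.\<close>
  have vec: "B x *v (cov_vector q (\<xi> i) (\<xi> j) x - cov_vector q (\<xi> j) (\<xi> i) x)
      = B x *v lie_bracket (\<xi> i) (\<xi> j) x" if "x \<in> D" for x i j
    by (simp add: cov_vector_torsion_free[where q = q, OF D that q_sym])
  have form: "p x *v (cov_form q (\<xi> i) (\<omega> j) x - cov_form q (\<xi> j) (\<omega> i) x)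
      = B x *v lie_bracket (\<xi> i) (\<xi> j) x" if "x \<in> D" for x i j
    unfolding vec[OF that, symmetric]
    by (simp add: cov_form_lower[where q = q, OF D that q \<xi> q_sym q_inv[OF that] flat_\<xi>]
        B_def matrix_vector_mult_diff_distrib matrix_vector_mul_assoc)

  have "cond_vectors \<longleftrightarrow> kernel_involutive D B"
  proof -
    have "(\<Sum>\<sigma>\<in>UNIV. \<Sum>l\<in>UNIV. p x $ \<tau> $ \<sigma> * q x $ \<sigma> $ l * v $ l) = (B x *v v) $ \<tau>" for x \<tau> v
      unfolding B_def matrix_vector_mul_assoc[symmetric]
      by (simp add: matrix_vector_mult_def sum_distrib_left mult_ac)
    then show ?thesis
      unfolding cond_vectors_def D_def[symmetric] p_def[symmetric] q_def[symmetric] frame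
      by (simp add: vec vec_eq_iff flip: vector_minus_component)
  qed
  moreover have forms: "cond_forms \<longleftrightarrow> kernel_involutive D B"
  proof -
    have "(\<Sum>\<sigma>\<in>UNIV. p x $ \<tau> $ \<sigma> * v $ \<sigma>) = (p x *v v) $ \<tau>" for x \<tau> v
      by (simp add: matrix_vector_mult_def)
    then show ?thesis
      unfolding cond_forms_def D_def[symmetric] p_def[symmetric] q_def[symmetric] frame
      by (simp add: form vec_eq_iff flip: vector_minus_component)
  qed
  moreover have "cond_bivector \<longleftrightarrow> kernel_involutive D B"
    unfolding cond_bivector_def D_def[symmetric] p_def[symmetric] q_def[symmetric] frame
    by (simp add: cov_bivector_wedge[OF D _ p \<omega> \<omega> \<omega>_cas \<omega>_cas] form vec_eq_iff flip: xi')
  moreover have "bracket_invariant \<longleftrightarrow> kernel_involutive D B"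
  proof
    assume bi: bracket_invariant
    have "\<omega> i \<in> casimir_forms D p" for i
      by (simp add: casimir_forms_def casimir_def \<omega> \<omega>_cas)
    then have "form_bracket q (\<omega> i) (\<omega> j) \<in> casimir_forms D p" for i j
      using bi by (simp add: bracket_invariant_def D_def p_def q_def)
    then show "kernel_involutive D B"
      unfolding frame
      by (simp add: casimir_forms_def casimir_def form_bracket_def flat_def B_def xi'
          matrix_vector_mul_assoc)
  next
    assume inv: "kernel_involutive D B"
    \<comment> \<open>Pointwise involutivity applies directly to the values of the raised forms, so
      arbitrary Casimir forms need no expansion in the basis with function coefficients.\<close>
    have "form_bracket q \<alpha> \<beta> \<in> casimir_forms D p"
      if \<alpha>: "\<alpha> \<in> casimir_forms D p" and \<beta>: "\<beta> \<in> casimir_forms D p" for \<alpha> \<beta>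
    proof -
      have s: "smooth_on D (sharp q \<alpha>)" "smooth_on D (sharp q \<beta>)"
        using \<alpha> \<beta> by (auto simp: casimir_forms_def intro: sharp_smooth)
      have z: "B x *v sharp q \<alpha> x = 0" "B x *v sharp q \<beta> x = 0" if "x \<in> D" for x
        using \<alpha> \<beta> that by (auto simp: casimir_forms_def casimir_def B_sharp)
      have "B x *v lie_bracket (sharp q \<alpha>) (sharp q \<beta>) x = 0" if "x \<in> D" for x
        using inv that z[OF that] unfolding kernel_involutive_def
        by (simp add: kernel_lie_bracket[OF D that B s z])
      moreover have "smooth_on D (\<lambda>x. q x *v lie_bracket (sharp q \<alpha>) (sharp q \<beta>) x)"
        by (intro smooth_on_matrix_vector_mult D q smooth_on_lie_bracket s)
      ultimately show ?thesis
        by (simp add: casimir_forms_def casimir_def form_bracket_def flat_def[abs_def] B_def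
            matrix_vector_mul_assoc)
    qed
    then show bracket_invariant
      by (simp add: bracket_invariant_def D_def p_def q_def)
  qed
  ultimately show ?thesis using integrable by simp
qed

end
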